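(* In the model with gas fees described in the context, consider the limit of the fast block regime $\lambda\to\infty$ and then small gas fees $\delta\to0^+$ (with $P>0$, $\sigma>0$, $\gamma>0$ and the pool fixed). Then the instantaneous rate of gas fees $\overline{\mathsf{GAS}}=\lambda(g_+\pi_++g_-\pi_-)$ satisfies $$ \lim_{\lambda\to\infty}\overline{\mathsf{GAS}}=\frac{\sigma^2P}{2}\times\frac{y^{*\prime}(Pe^{-\gamma})+e^{+\gamma}\,y^{*\prime}(Pe^{+\gamma})}{2}\times\frac{\delta}{2\gamma}+o(\delta)\qquad\text{as }\delta\to0^+. $$
   Context: Mispricing process with gas fees. For $\sigma,\lambda,\gamma,\delta>0$, $\bar\gamma=\gamma+\delta$, the process $z_t$ satisfies $dz_t=\sigma\,dB_t$ ($B$ standard Brownian motion) between the arrival times of an independent Poisson process of rate $\lambda$; at an arrival time $t$: if $z_{t^-}>\bar\gamma$ then $z_t=\gamma$; if $z_{t^-}<-\bar\gamma$ then $z_t=-\gamma$; otherwise $z_t=z_{t^-}$. It has a unique invariant distribution $\pi$; $\pi_+=\pi((\bar\gamma,\infty))$ and $\pi_-=\pi((-\infty,-\bar\gamma))$, and with $\eta=\sqrt{2\lambda}\bar\gamma/\sigma$ one has $\pi_+=\pi_-=\frac{1}{2+2\eta+\eta^2(1-(\gamma/(\gamma+\delta))^2)}$. Pool. $f:\mathbb{R}_+^2\to\mathbb{R}$ is a bonding function and $L\in\mathbb{R}$; $V(P)=\min\{Px+y:(x,y)\in\mathbb{R}^2_+,\ f(x,y)=L\}$. Assume an optimal solution $(x^*(P),y^*(P))$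 exists for every $P\ge0$ and $V$ is everywhere twice continuously differentiable. Primes denote derivatives in price. Gas costs valued in the numéraire: $g_+=P\{x^*(Pe^{-\gamma-\delta})-x^*(Pe^{-\gamma})\}+e^{\gamma}\{y^*(Pe^{-\gamma-\delta})-y^*(Pe^{-\gamma})\}$, $g_-=e^{\gamma}P\{x^*(Pe^{\gamma+\delta})-x^*(Pe^{\gamma})\}+\{y^*(Pe^{\gamma+\delta})-y^*(Pe^{\gamma})\}$. *)

theory Defs
  imports "HOL-Probability.Probability" "HOL-Library.Landau_Symbols"
begin

section \<open>The mispricing process\<close>

text \<open>The trajectory up to time \<open>t\<close>, and the whole trajectory, as random elements of a
  product space.\<close>

abbreviation path_upto :: "(real \<Rightarrow> 'w \<Rightarrow> 'b) \<Rightarrow> real \<Rightarrow> 'w \<Rightarrow> real \<Rightarrow> 'b" where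
  "path_upto X t \<equiv> (\<lambda>\<omega>. \<lambda>s\<in>{0..t}. X s \<omega>)"

abbreviation full_path :: "(real \<Rightarrow> 'w \<Rightarrow> 'b) \<Rightarrow> 'w \<Rightarrow> real \<Rightarrow> 'b" where
  "full_path X \<equiv> (\<lambda>\<omega>. \<lambda>s\<in>{0..}. X s \<omega>)"

text \<open>The library's \<open>indep_var\<close> forces both random variables to have the same value type; this is
  the same notion without that restriction.\<close>

definition indep_random_vars ::
  "'w measure \<Rightarrow> 'a measure \<Rightarrow> ('w \<Rightarrow> 'a) \<Rightarrow> 'b measure \<Rightarrow> ('w \<Rightarrow> 'b) \<Rightarrow> bool" where
  "indep_random_vars M S X T Y \<longleftrightarrow>
     X \<in> measurable M S \<and> Y \<in> measurable M T \<and>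
     prob_space.indep_set M {X -` A \<inter> space M | A. A \<in> sets S}
                            {Y -` A \<inter> space M | A. A \<in> sets T}"

locale standard_brownian_motion = prob_space M
  for M :: "'w measure" and B :: "real \<Rightarrow> 'w \<Rightarrow> real" +
  assumes bm_measurable: "\<And>t. 0 \<le> t \<Longrightarrow> B t \<in> borel_measurable M"
    and bm_start: "AE \<omega> in M. B 0 \<omega> = 0"
    and bm_continuous: "AE \<omega> in M. continuous_on {0..} (\<lambda>t. B t \<omega>)"
    and bm_gaussian: "\<And>s t. 0 \<le> s \<Longrightarrow> s < t \<Longrightarrow>
          distributed M lborel (\<lambda>\<omega>. B t \<omega> - B s \<omega>) (normal_density 0 (sqrt (t - s)))"
    and bm_independent_increments: "\<And>s t. 0 \<le> s \<Longrightarrow> s < t \<Longrightarrow>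
          indep_random_vars M borel (\<lambda>\<omega>. B t \<omega> - B s \<omega>) (\<Pi>\<^sub>M u\<in>{0..s}. borel) (path_upto B s)"

text \<open>The truncated subtraction on \<open>nat\<close> is harmless, since almost every path is monotone.\<close>

locale poisson_process = prob_space M
  for M :: "'w measure" and N :: "real \<Rightarrow> 'w \<Rightarrow> nat" and rate :: real +
  assumes rate_pos: "0 < rate"
    and poisson_measurable: "\<And>t. 0 \<le> t \<Longrightarrow> N t \<in> measurable M (count_space UNIV)"
    and poisson_start: "AE \<omega> in M. N 0 \<omega> = 0"
    and poisson_mono: "AE \<omega> in M. mono_on {0..} (\<lambda>t. N t \<omega>)"
    and poisson_right_continuous:
          "AE \<omega> in M. \<forall>t\<ge>0. continuous (at_right t) (\<lambda>s. N s \<omega>)"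
    and poisson_increments: "\<And>s t. 0 \<le> s \<Longrightarrow> s < t \<Longrightarrow>
          distr M (count_space UNIV) (\<lambda>\<omega>. N t \<omega> - N s \<omega>)
            = measure_pmf (poisson_pmf (rate * (t - s)))"
    and poisson_independent_increments: "\<And>s t. 0 \<le> s \<Longrightarrow> s < t \<Longrightarrow>
          indep_random_vars M (count_space UNIV) (\<lambda>\<omega>. N t \<omega> - N s \<omega>)
            (\<Pi>\<^sub>M u\<in>{0..s}. count_space UNIV) (path_upto N s)"

definition arrival_time :: "(real \<Rightarrow> nat) \<Rightarrow> real \<Rightarrow> bool" where
  "arrival_time n t \<longleftrightarrow> 0 < t \<and> (\<forall>s\<in>{0..<t}. n s < n t)"

definition arb_reset :: "real \<Rightarrow> real \<Rightarrow> real \<Rightarrow> real" where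
  "arb_reset \<gamma> \<delta> x =
     (if x > \<gamma> + \<delta> then \<gamma> else if x < - (\<gamma> + \<delta>) then - \<gamma> else x)"

locale mispricing_process =
  standard_brownian_motion M B + poisson_process M N rate
  for M :: "'w measure" and B :: "real \<Rightarrow> 'w \<Rightarrow> real" and N :: "real \<Rightarrow> 'w \<Rightarrow> nat"
    and rate :: real +
  fixes \<sigma> \<gamma> \<delta> :: real and z :: "real \<Rightarrow> 'w \<Rightarrow> real"
  assumes z_measurable: "\<And>t. 0 \<le> t \<Longrightarrow> z t \<in> borel_measurable M"
    and brownian_poisson_independent:
          "indep_random_vars M (\<Pi>\<^sub>M t\<in>{0..}. borel) (full_path B)
                     (\<Pi>\<^sub>M t\<in>{0..}. count_space UNIV) (full_path N)"
    and initial_independent: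
          "indep_random_vars M borel (z 0)
             ((\<Pi>\<^sub>M t\<in>{0..}. borel) \<Otimes>\<^sub>M (\<Pi>\<^sub>M t\<in>{0..}. count_space UNIV))
             (\<lambda>\<omega>. (full_path B \<omega>, full_path N \<omega>))"
    and z_between_arrivals:
          "AE \<omega> in M. \<forall>s t. 0 \<le> s \<longrightarrow> s \<le> t \<longrightarrow>
             (\<forall>u\<in>{s<..t}. \<not> arrival_time (\<lambda>r. N r \<omega>) u) \<longrightarrow>
             z t \<omega> - z s \<omega> = \<sigma> * (B t \<omega> - B s \<omega>)"
    and z_at_arrivals:
          "AE \<omega> in M. \<forall>t. arrival_time (\<lambda>r. N r \<omega>) t \<longrightarrow>
             (\<exists>l. ((\<lambda>s. z s \<omega>) \<longlongrightarrow> l) (at_left t) \<and> z t \<omega> = arb_reset \<gamma> \<delta> l)"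

text \<open>A distribution is invariant if a process started from it keeps it as its law at all
  times. The law of the process is determined by its initial law, so it does not matter which
  realization is used. The argument \<open>\<Omega>\<close> only fixes the type of the sample space.\<close>

definition invariant_distribution ::
  "'w itself \<Rightarrow> real \<Rightarrow> real \<Rightarrow> real \<Rightarrow> real \<Rightarrow> real measure \<Rightarrow> bool" where
  "invariant_distribution \<Omega> \<sigma> rate \<gamma> \<delta> \<pi> \<longleftrightarrow>
     (\<exists>(M :: 'w measure) B N z. mispricing_process M B N rate \<sigma> \<gamma> \<delta> z \<and>
        (\<forall>t\<ge>0. distr M borel (z t) = \<pi>))"

section \<open>The pool\<close>

definition pool_reserves :: "(real \<times> real \<Rightarrow> real) \<Rightarrow> real \<Rightarrow> (real \<times> real) set" where
  "pool_reserves f L = {(x, y). 0 \<le> x \<and> 0 \<le> y \<and> f (x, y) = L}"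

text \<open>The infimum is a minimum as soon as optimal reserves exist.\<close>

definition pool_value :: "(real \<times> real \<Rightarrow> real) \<Rightarrow> real \<Rightarrow> real \<Rightarrow> real" where
  "pool_value f L P = (INF (x, y)\<in>pool_reserves f L. P * x + y)"

definition optimal_reserves ::
  "(real \<times> real \<Rightarrow> real) \<Rightarrow> real \<Rightarrow> real \<Rightarrow> real \<times> real \<Rightarrow> bool" where
  "optimal_reserves f L P =
     is_arg_min (\<lambda>(x, y). P * x + y) (\<lambda>r. r \<in> pool_reserves f L)"

text \<open>Two-sided derivatives: meant for open \<open>S\<close>.\<close>

definition C2_on :: "real set \<Rightarrow> (real \<Rightarrow> real) \<Rightarrow> bool" where
  "C2_on S V \<longleftrightarrow> (\<exists>V' V''.
     (\<forall>P\<in>S. (V has_real_derivative V' P) (at P)) \<and>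
     (\<forall>P\<in>S. (V' has_real_derivative V'' P) (at P)) \<and>
     continuous_on S V'')"

section \<open>Gas fees\<close>

text \<open>Below \<open>xs\<close> and \<open>ys\<close> are the optimal reserves \<open>x\<^sup>*\<close> and \<open>y\<^sup>*\<close> as functions of the price.\<close>

definition gas_plus ::
  "(real \<Rightarrow> real) \<Rightarrow> (real \<Rightarrow> real) \<Rightarrow> real \<Rightarrow> real \<Rightarrow> real \<Rightarrow> real" where
  "gas_plus xs ys P \<gamma> \<delta> =
     P * (xs (P * exp (- \<gamma> - \<delta>)) - xs (P * exp (- \<gamma>)))
     + exp \<gamma> * (ys (P * exp (- \<gamma> - \<delta>)) - ys (P * exp (- \<gamma>)))"

definition gas_minus ::
  "(real \<Rightarrow> real) \<Rightarrow> (real \<Rightarrow> real) \<Rightarrow> real \<Rightarrow> real \<Rightarrow> real \<Rightarrow> real" where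
  "gas_minus xs ys P \<gamma> \<delta> =
     exp \<gamma> * P * (xs (P * exp (\<gamma> + \<delta>)) - xs (P * exp \<gamma>))
     + (ys (P * exp (\<gamma> + \<delta>)) - ys (P * exp \<gamma>))"

definition gas_rate ::
  "(real \<Rightarrow> real) \<Rightarrow> (real \<Rightarrow> real) \<Rightarrow> real \<Rightarrow> real \<Rightarrow> real \<Rightarrow> real \<Rightarrow> real measure \<Rightarrow> real" where
  "gas_rate xs ys P rate \<gamma> \<delta> \<pi> =
     rate * (gas_plus xs ys P \<gamma> \<delta> * measure \<pi> {\<gamma> + \<delta><..}
             + gas_minus xs ys P \<gamma> \<delta> * measure \<pi> {..<- (\<gamma> + \<delta>)})"

end

theory Submission
  imports Defs "HOL-Real_Asymp.Real_Asymp"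
begin

text \<open>Stationarity gives \<open>\<integral> (\<sigma>\<^sup>2 h'' / 2 + \<lambda> (h \<circ> reset - h)) d\<pi> = 0\<close> for bounded \<open>h\<close> with Lipschitz
  derivative that is twice differentiable off the barriers \<open>\<plusminus>(\<gamma> + \<delta>)\<close>: the law has no atoms there,
  so the kink of \<open>h'\<close> does not matter. Choosing \<open>h\<close> linear, respectively quadratic, between the
  barriers and exponentially saturating outside makes the integrand constant on each of the three
  regions, which yields \<open>\<pi>\<^sub>+ = \<pi>\<^sub>-\<close> and then their value; in particular
  \<open>\<lambda> \<pi>\<^sub>\<plusminus> \<longlonglongrightarrow> \<sigma>\<^sup>2 / (2 ((\<gamma> + \<delta>)\<^sup>2 - \<gamma>\<^sup>2))\<close>. By the envelope theorem \<open>x\<^sup>* = V'\<close> and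
  \<open>y\<^sup>* = V - P V'\<close>, so each gas cost is a multiple of a Bregman remainder of \<open>V\<close>, hence of order \<open>\<delta>\<^sup>2\<close>.\<close>

section \<open>Independence\<close>

text \<open>The invariant law is given only as a law kept by some realization, and the process only
  through its paths and independences, so the generator identity has to be read off from comparing
  \<open>z t\<close> with \<open>z 0\<close> at small \<open>t\<close>. The time of an arrival is
  random, and its joint law with \<open>B\<close> is avoided: on a single arrival only the
  oscillation of \<open>B\<close> over all of \<open>{0..t}\<close> is used, an event decided by
  \<open>(z 0, B)\<close>, while \<open>N\<close> enters through the independent number
  \<open>N t\<close>. The density of \<pi> is unknown, so a usable test function must turn the
  identity into a relation between probabilities. Three regions carry three unknown masses; two test
  functions and total mass one determine them. The linear one is blind to the middle region, where
  its second derivative vanishes; the quadratic one sees it. The final order is a product: losses of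
  order \<open>\<delta>\<^sup>2\<close> times exit rates of order \<open>1 / \<delta>\<close>,
  because \<open>(\<gamma> + \<delta>)\<^sup>2 - \<gamma>\<^sup>2 = \<delta> * (2 * \<gamma> +
  \<delta>)\<close>. This is the origin of \<open>2 * \<gamma>\<close> in the denominator.\<close>

lemma indep_random_vars_compose:
  assumes "prob_space M" and XY: "indep_random_vars M S X T Y"
    and F: "F \<in> measurable S A" and G: "G \<in> measurable T B"
  shows "indep_random_vars M A (\<lambda>\<omega>. F (X \<omega>)) B (\<lambda>\<omega>. G (Y \<omega>))"
proof -
  interpret prob_space M by fact
  have X: "X \<in> measurable M S" and Y: "Y \<in> measurable M T"
    and ind: "indep_set {X -` A \<inter> space M | A. A \<in> sets S} {Y -` A \<inter> space M | A. A \<in> sets T}"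
    using XY by (auto simp: indep_random_vars_def)
  have "prob (((\<lambda>\<omega>. F (X \<omega>)) -` C \<inter> space M) \<inter> ((\<lambda>\<omega>. G (Y \<omega>)) -` D \<inter> space M))
      = prob ((\<lambda>\<omega>. F (X \<omega>)) -` C \<inter> space M) * prob ((\<lambda>\<omega>. G (Y \<omega>)) -` D \<inter> space M)"
    if "C \<in> sets A" "D \<in> sets B" for C D
  proof (rule indep_setD[OF ind])
    have "(\<lambda>\<omega>. F (X \<omega>)) -` C \<inter> space M = X -` (F -` C \<inter> space S) \<inter> space M"
      using measurable_space[OF X] by auto
    then show "(\<lambda>\<omega>. F (X \<omega>)) -` C \<inter> space M \<in> {X -` A \<inter> space M | A. A \<in> sets S}"
      using measurable_sets[OF F that(1)] by blast
    have "(\<lambda>\<omega>. G (Y \<omega>)) -` D \<inter> space M = Y -` (G -` D \<inter> space T) \<inter> space M"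
      using measurable_space[OF Y] by auto
    then show "(\<lambda>\<omega>. G (Y \<omega>)) -` D \<inter> space M \<in> {Y -` A \<inter> space M | A. A \<in> sets T}"
      using measurable_sets[OF G that(2)] by blast
  qed
  moreover have FX: "(\<lambda>\<omega>. F (X \<omega>)) \<in> measurable M A" and GY: "(\<lambda>\<omega>. G (Y \<omega>)) \<in> measurable M B"
    using measurable_compose[OF X F] measurable_compose[OF Y G] by auto
  ultimately show ?thesis
    unfolding indep_random_vars_def indep_sets2_eq by (auto intro: measurable_sets)
qed

text \<open>Preimages are closed under intersection, so independence passes to the sigma-algebras
  they generate, of which \<open>indep_var\<close> speaks. This opens the way to the product rule
  for expectations and to product laws.\<close>

lemma indep_var_if_indep_random_vars:
  assumes "prob_space M" and XY: "indep_random_vars M S X T Y"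
  shows "prob_space.indep_var M S X T Y"
proof -
  interpret prob_space M by fact
  have *: "Int_stable {Z -` A \<inter> space M | A. A \<in> sets U}" for Z :: "'a \<Rightarrow> 'b" and U
  proof (rule Int_stableI, safe)
    fix C D assume "C \<in> sets U" "D \<in> sets U"
    then show "\<exists>E. (Z -` C \<inter> space M) \<inter> (Z -` D \<inter> space M) = Z -` E \<inter> space M \<and> E \<in> sets U"
      by (intro exI[of _ "C \<inter> D"]) auto
  qed
  show ?thesis
    unfolding indep_var_eq
    using XY * by (auto simp: indep_random_vars_def intro!: indep_set_sigma_sets)
qed

text \<open>The three-fold product formula holds on rectangles, and rectangles form a generating
  pi-system. With \<open>z 0\<close>, \<open>B\<close>, \<open>N\<close> in the three places it
  makes the arrival count independent of everything decided by start and Brownian path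
  together.\<close>

lemma indep_random_vars_assoc:
  assumes "prob_space M" and X: "indep_random_vars M S X (T \<Otimes>\<^sub>M U) (\<lambda>\<omega>. (Y \<omega>, Z \<omega>))"
    and YZ: "indep_random_vars M T Y U Z"
  shows "indep_random_vars M (S \<Otimes>\<^sub>M T) (\<lambda>\<omega>. (X \<omega>, Y \<omega>)) U Z"
proof -
  interpret prob_space M by fact
  have mX: "X \<in> measurable M S" and mY: "Y \<in> measurable M T" and mZ: "Z \<in> measurable M U"
    using X YZ by (auto simp: indep_random_vars_def)
  \<comment> \<open>\<open>E\<close> holds the preimages of rectangles under the pair: closed under
    intersection and generating its sigma-algebra.\<close>
  define E where "E = {(X -` A \<inter> space M) \<inter> (Y -` B \<inter> space M) | A B. A \<in> sets S \<and> B \<in> sets T}"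
  define F where "F = {Z -` C \<inter> space M | C. C \<in> sets U}"
  have *: "prob ((X -` A \<inter> space M) \<inter> (Y -` B \<inter> space M) \<inter> (Z -` C \<inter> space M))
      = prob (X -` A \<inter> space M) * (prob (Y -` B \<inter> space M) * prob (Z -` C \<inter> space M))"
    if A: "A \<in> sets S" "B \<in> sets T" "C \<in> sets U" for A B C
  proof -
    have "prob ((X -` A \<inter> space M) \<inter> ((\<lambda>\<omega>. (Y \<omega>, Z \<omega>)) -` (B \<times> C) \<inter> space M))
        = prob (X -` A \<inter> space M) * prob ((\<lambda>\<omega>. (Y \<omega>, Z \<omega>)) -` (B \<times> C) \<inter> space M)"
      using X A unfolding indep_random_vars_def
      by (intro indep_setD[where A="{X -` A \<inter> space M | A. A \<in> sets S}"
            and B="{(\<lambda>\<omega>. (Y \<omega>, Z \<omega>)) -` A \<inter> space M | A. A \<in> sets (T \<Otimes>\<^sub>M U)}"]) blast+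
    moreover have "(\<lambda>\<omega>. (Y \<omega>, Z \<omega>)) -` (B \<times> C) \<inter> space M = (Y -` B \<inter> space M) \<inter> (Z -` C \<inter> space M)"
      by auto
    moreover have "prob ((Y -` B \<inter> space M) \<inter> (Z -` C \<inter> space M))
        = prob (Y -` B \<inter> space M) * prob (Z -` C \<inter> space M)"
      using YZ A unfolding indep_random_vars_def
      by (intro indep_setD[where A="{Y -` A \<inter> space M | A. A \<in> sets T}"
            and B="{Z -` A \<inter> space M | A. A \<in> sets U}"]) blast+
    ultimately show ?thesis by (simp add: Int_assoc)
  qed
  have Zsp: "Z -` space U \<inter> space M = space M" and Ysp: "Y -` space T \<inter> space M = space M"
    and Xsp: "X -` space S \<inter> space M = space M"
    using measurable_space[OF mZ] measurable_space[OF mY] measurable_space[OF mX] by auto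
  \<comment> \<open>The case \<open>C = space U\<close> of the three-fold formula.\<close>
  have **: "prob ((X -` A \<inter> space M) \<inter> (Y -` B \<inter> space M))
      = prob (X -` A \<inter> space M) * prob (Y -` B \<inter> space M)"
    if "A \<in> sets S" "B \<in> sets T" for A B
    using *[OF that sets.top[of U]] by (simp add: Zsp prob_space Int_assoc)
  have Eev: "E \<subseteq> events" and Fev: "F \<subseteq> events"
    using mX mY mZ by (auto simp: E_def F_def)
  have "indep_set E F"
    using Eev Fev
  proof (rule indep_setI)
    fix a b assume "a \<in> E" "b \<in> F"
    then obtain A B C where "A \<in> sets S" "B \<in> sets T" "C \<in> sets U"
      "a = (X -` A \<inter> space M) \<inter> (Y -` B \<inter> space M)" "b = Z -` C \<inter> space M"
      by (auto simp: E_def F_def)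
    then show "prob (a \<inter> b) = prob a * prob b" using * ** by simp
  qed
  moreover have "Int_stable E"
  proof (rule Int_stableI)
    fix a b assume "a \<in> E" "b \<in> E"
    then obtain A B A' B' where AB: "A \<in> sets S" "B \<in> sets T" "A' \<in> sets S" "B' \<in> sets T"
      "a = (X -` A \<inter> space M) \<inter> (Y -` B \<inter> space M)" "b = (X -` A' \<inter> space M) \<inter> (Y -` B' \<inter> space M)"
      by (auto simp: E_def)
    then have "a \<inter> b = (X -` (A \<inter> A') \<inter> space M) \<inter> (Y -` (B \<inter> B') \<inter> space M)" by auto
    with AB show "a \<inter> b \<in> E" unfolding E_def by blast
  qed
  moreover have "Int_stable F"
  proof (rule Int_stableI)
    fix a b assume "a \<in> F" "b \<in> F"
    then obtain A B where AB: "A \<in> sets U" "B \<in> sets U" "a = Z -` A \<inter> space M" "b = Z -` B \<inter> space M"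
      by (auto simp: F_def)
    then have "a \<inter> b = Z -` (A \<inter> B) \<inter> space M" by auto
    with AB show "a \<inter> b \<in> F" unfolding F_def by blast
  qed
  ultimately have ind: "indep_set (sigma_sets (space M) E) (sigma_sets (space M) F)"
    by (rule indep_set_sigma_sets)
  have Epow: "E \<subseteq> Pow (space M)" by (auto simp: E_def)
  \<comment> \<open>Both components are measurable for the sigma-algebra generated by
    \<open>E\<close>, hence so is the pair; this puts every preimage under the pair, not only those
    of rectangles, into \<open>sigma_sets (space M) E\<close>.\<close>
  let ?N = "sigma (space M) E"
  have "X \<in> measurable ?N S"
  proof (rule measurableI)
    fix A assume "A \<in> sets S"
    then have "X -` A \<inter> space M \<in> E"
      unfolding E_def using Ysp sets.top[of T] by blast
    then show "X -` A \<inter> space ?N \<in> sets ?N" using Epow by (simp add: space_measure_of)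
  qed (use measurable_space[OF mX] Epow in \<open>simp add: space_measure_of\<close>)
  moreover have "Y \<in> measurable ?N T"
  proof (rule measurableI)
    fix A assume "A \<in> sets T"
    then have "Y -` A \<inter> space M \<in> E"
      unfolding E_def using Xsp sets.top[of S] by blast
    then show "Y -` A \<inter> space ?N \<in> sets ?N" using Epow by (simp add: space_measure_of)
  qed (use measurable_space[OF mY] Epow in \<open>simp add: space_measure_of\<close>)
  ultimately have "(\<lambda>\<omega>. (X \<omega>, Y \<omega>)) \<in> measurable ?N (S \<Otimes>\<^sub>M T)" by (rule measurable_Pair)
  then have "(\<lambda>\<omega>. (X \<omega>, Y \<omega>)) -` D \<inter> space M \<in> sigma_sets (space M) E" if "D \<in> sets (S \<Otimes>\<^sub>M T)" for D
    using measurable_sets[OF _ that] Epow by (metis sets_measure_of space_measure_of)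
  moreover have "Z -` C \<inter> space M \<in> sigma_sets (space M) F" if "C \<in> sets U" for C
    using that by (auto simp: F_def)
  ultimately have "indep_set {(\<lambda>\<omega>. (X \<omega>, Y \<omega>)) -` D \<inter> space M | D. D \<in> sets (S \<Otimes>\<^sub>M T)}
      {Z -` C \<inter> space M | C. C \<in> sets U}"
    using ind mX mY mZ unfolding indep_sets2_eq by (auto intro!: measurable_sets)
  then show ?thesis
    unfolding indep_random_vars_def using mX mY mZ by simp
qed

section \<open>Paths with at most one arrival\<close>

text \<open>The arrival is the infimum \<open>T\<close> of the times at which the path already has
  its final value. Right continuity makes the infimum attained, and an increment of one leaves no
  room for a second strict increase before or after \<open>T\<close>.\<close>

lemma arrival_time_at_single_increment:
  fixes n :: "real \<Rightarrow> nat"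
  assumes mono: "mono_on {0..} n" and rc: "\<forall>t\<ge>0. continuous (at_right t) n"
    and t: "0 \<le> t" and jump: "n t = Suc (n 0)"
  obtains T where "0 < T" "T \<le> t" "arrival_time n T"
    "\<And>u. 0 < u \<Longrightarrow> u \<le> t \<Longrightarrow> arrival_time n u \<Longrightarrow> u = T"
proof -
  define S where "S = {s. 0 \<le> s \<and> s \<le> t \<and> n s = n t}"
  define T where "T = Inf S"
  have tS: "t \<in> S" using t by (simp add: S_def)
  have bdd: "bdd_below S" by (rule bdd_belowI[of _ 0]) (simp add: S_def)
  have T0: "0 \<le> T" unfolding T_def using tS by (intro cInf_greatest) (auto simp: S_def)
  have Tt: "T \<le> t" unfolding T_def using tS bdd by (rule cInf_lower)
  have le: "n u \<le> n v" if "0 \<le> u" "u \<le> v" for u v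
    using mono_onD[OF mono] that by auto
  \<comment> \<open>The values are discrete, so right continuity means that \<open>n\<close> is
    constant just after \<open>T\<close>, where elements of \<open>S\<close> occur.\<close>
  have "(n \<longlongrightarrow> n T) (at_right T)" using rc T0 by (simp add: continuous_within)
  then have "eventually (\<lambda>s. n s = n T) (at_right T)" by (simp add: tendsto_discrete)
  then obtain b where b: "b > T" "\<And>y. y > T \<Longrightarrow> y < b \<Longrightarrow> n y = n T"
    by (auto simp: eventually_at_right_field)
  obtain s where s: "s \<in> S" "s < b" using b(1) tS bdd cInf_less_iff[of S b] unfolding T_def by auto
  have "T \<le> s" unfolding T_def using s(1) bdd by (rule cInf_lower)
  then have nT: "n T = n t" using s b(2)[of s] by (cases "s = T") (auto simp: S_def)
  then have Tpos: "0 < T" using jump T0 by (cases "T = 0") auto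
  have below: "n u < n T" if "0 \<le> u" "u < T" for u
  proof -
    have "u \<notin> S" using that cInf_lower[OF _ bdd, of u] by (force simp: T_def)
    then have "n u \<noteq> n t" using that Tt by (auto simp: S_def)
    then show ?thesis using le[OF that(1), of T] that nT by simp
  qed
  show thesis
  proof (rule that[OF Tpos Tt])
    show "arrival_time n T" using Tpos below by (auto simp: arrival_time_def)
    fix u assume u: "0 < u" "u \<le> t" "arrival_time n u"
    have "n 0 < n u" using u by (auto simp: arrival_time_def)
    then have "\<not> u < T" using below[of u] u nT jump by auto
    moreover have "\<not> T < u"
    proof
      assume "T < u"
      then have "n T < n u" using u(3) T0 by (auto simp: arrival_time_def)
      then show False using le[of u t] u nT by auto
    qed
    ultimately show "u = T" by simp
  qed
qed

lemma no_arrival_time_if_no_increment: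
  fixes n :: "real \<Rightarrow> nat"
  assumes mono: "mono_on {0..} n" and "n t = n 0" and u: "0 < u" "u \<le> t"
  shows "\<not> arrival_time n u"
proof
  assume "arrival_time n u"
  then have "n 0 < n u" using u by (auto simp: arrival_time_def)
  moreover have "n u \<le> n t" using mono_onD[OF mono, of u t] u by auto
  ultimately show False using assms by simp
qed

text \<open>Before the arrival the path follows \<open>b\<close>, so its left limit there is given
  by continuity of \<open>b\<close>; after the arrival it follows \<open>b\<close> again. The time
  \<open>T\<close> is only located in \<open>{0<..t}\<close>, which is all that the estimates
  use.\<close>

lemma path_with_single_arrival:
  fixes z b :: "real \<Rightarrow> real" and n :: "real \<Rightarrow> nat"
  assumes b: "continuous_on {0..} b"
    and mono: "mono_on {0..} n" and rc: "\<forall>t\<ge>0. continuous (at_right t) n"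
    and t: "0 \<le> t" and jump: "n t = Suc (n 0)"
    and between: "\<forall>s t. 0 \<le> s \<longrightarrow> s \<le> t \<longrightarrow> (\<forall>u\<in>{s<..t}. \<not> arrival_time n u) \<longrightarrow>
             z t - z s = \<sigma> * (b t - b s)"
    and at: "\<forall>t. arrival_time n t \<longrightarrow> (\<exists>l. (z \<longlongrightarrow> l) (at_left t) \<and> z t = arb_reset \<gamma> \<delta> l)"
  obtains T where "0 < T" "T \<le> t"
    "z t = arb_reset \<gamma> \<delta> (z 0 + \<sigma> * (b T - b 0)) + \<sigma> * (b t - b T)"
proof -
  obtain T where T: "0 < T" "T \<le> t" "arrival_time n T"
    and uniq: "\<And>u. 0 < u \<Longrightarrow> u \<le> t \<Longrightarrow> arrival_time n u \<Longrightarrow> u = T"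
    using arrival_time_at_single_increment[OF mono rc t jump] by blast
  obtain l where l: "(z \<longlongrightarrow> l) (at_left T)" "z T = arb_reset \<gamma> \<delta> l" using at T(3) by blast
  have "eventually (\<lambda>s. z s = z 0 + \<sigma> * (b s - b 0)) (at_left T)"
    using eventually_at_left_real[OF T(1)]
  proof eventually_elim
    case (elim s)
    have "\<not> arrival_time n u" if "u \<in> {0<..s}" for u
      using uniq[of u] that elim T by force
    then show ?case using between[rule_format, of 0 s] elim by force
  qed
  then have "((\<lambda>s. z 0 + \<sigma> * (b s - b 0)) \<longlongrightarrow> l) (at_left T)"
    using l(1) by (rule Lim_transform_eventually[rotated])
  moreover have "(b \<longlongrightarrow> b T) (at T)"
    using b T(1) by (metis continuous_on_interior isContD interior_real_atLeast greaterThan_iff)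
  then have "((\<lambda>s. z 0 + \<sigma> * (b s - b 0)) \<longlongrightarrow> z 0 + \<sigma> * (b T - b 0)) (at_left T)"
    by (intro tendsto_intros) (auto intro: tendsto_within_subset)
  ultimately have "l = z 0 + \<sigma> * (b T - b 0)"
    by (rule tendsto_unique[OF trivial_limit_at_left_real])
  moreover have "z t - z T = \<sigma> * (b t - b T)"
  proof (rule between[rule_format])
    show "\<not> arrival_time n u" if "u \<in> {T<..t}" for u
      using uniq[of u] that T(1) by fastforce
  qed (use T in auto)
  ultimately show thesis using that[OF T(1,2)] l(2) by simp
qed

text \<open>A shift of at most half the distance to the barriers keeps the point in its region, and
  on each region the reset is constant or the identity.\<close>

lemma arb_reset_perturb:
  assumes "0 < \<gamma>" "0 < \<delta>" "\<bar>x\<bar> \<noteq> \<gamma> + \<delta>" "2 * \<bar>u\<bar> \<le> \<bar>\<bar>x\<bar> - (\<gamma> + \<delta>)\<bar>"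
  shows "\<bar>arb_reset \<gamma> \<delta> (x + u) - arb_reset \<gamma> \<delta> x\<bar> \<le> \<bar>u\<bar>"
  using assms by (auto simp: arb_reset_def abs_if split: if_splits)

lemma borel_measurable_arb_reset [measurable]: "arb_reset \<gamma> \<delta> \<in> borel_measurable borel"
  unfolding arb_reset_def by measurable

section \<open>Second-order expansions\<close>

text \<open>By the mean value theorem, with a bound that holds across the kinks of \<open>h'\<close>
  as well. It provides the dominating function for the Gaussian expansion.\<close>

lemma lipschitz_derivative_remainder:
  fixes h h' :: "real \<Rightarrow> real"
  assumes h: "\<And>x. (h has_real_derivative h' x) (at x)"
    and lip: "\<And>x y. \<bar>h' x - h' y\<bar> \<le> K * \<bar>x - y\<bar>"
  shows "\<bar>h (x + u) - h x - h' x * u\<bar> \<le> K * u\<^sup>2"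
proof (cases "u = 0")
  case False
  have "\<exists>\<xi>. \<bar>\<xi> - x\<bar> \<le> \<bar>u\<bar> \<and> h (x + u) - h x = u * h' \<xi>"
  proof (cases "0 < u")
    case True
    then obtain \<xi> where "x < \<xi>" "\<xi> < x + u" "h (x + u) - h x = (x + u - x) * h' \<xi>"
      using MVT2[of x "x + u" h h'] h by auto
    then show ?thesis by (intro exI[of _ \<xi>]) auto
  next
    case 2: False
    with False obtain \<xi> where "x + u < \<xi>" "\<xi> < x" "h x - h (x + u) = (x - (x + u)) * h' \<xi>"
      using MVT2[of "x + u" x h h'] h by auto
    then show ?thesis by (intro exI[of _ \<xi>]) auto
  qed
  then obtain \<xi> where \<xi>: "\<bar>\<xi> - x\<bar> \<le> \<bar>u\<bar>" "h (x + u) - h x = u * h' \<xi>" by blast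
  have K: "0 \<le> K" using lip[of 0 1] by simp
  have "\<bar>h (x + u) - h x - h' x * u\<bar> = \<bar>u\<bar> * \<bar>h' \<xi> - h' x\<bar>"
    using \<xi>(2) by (simp add: abs_mult[symmetric] algebra_simps)
  also have "\<dots> \<le> \<bar>u\<bar> * (K * \<bar>u\<bar>)"
    using lip[of \<xi> x] mult_left_mono[OF \<xi>(1) K] by (intro mult_left_mono) auto
  finally show ?thesis by (simp add: power2_eq_square algebra_simps)
qed simp

text \<open>One use of L'Hopital leaves half the difference quotient of \<open>h'\<close> at
  \<open>x\<close>, so a second derivative at the single point \<open>x\<close> is enough.\<close>

lemma second_order_difference_quotient:
  fixes h h' :: "real \<Rightarrow> real"
  assumes S: "open S" "x \<in> S" and h: "\<And>y. y \<in> S \<Longrightarrow> (h has_real_derivative h' y) (at y)"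
    and h': "(h' has_real_derivative D) (at x)"
  shows "((\<lambda>u. (h (x + u) - h x - h' x * u) / u\<^sup>2) \<longlongrightarrow> D / 2) (at 0)"
proof (rule lhopital[where f'="\<lambda>u. h' (x + u) - h' x" and g'="\<lambda>u. 2 * u"])
  have "isCont h x" using h[OF S(2)] by (rule DERIV_isCont)
  then have "((\<lambda>u. h (x + u) - h x - h' x * u) \<longlongrightarrow> h x - h x - h' x * 0) (at 0)"
    by (intro tendsto_intros) (simp add: LIM_isCont_iff isCont_def LIM_offset_zero_iff)
  then show "((\<lambda>u. h (x + u) - h x - h' x * u) \<longlongrightarrow> 0) (at 0)" by simp
  show "((\<lambda>u::real. u\<^sup>2) \<longlongrightarrow> 0) (at 0)" by real_asymp
  show "eventually (\<lambda>u::real. u\<^sup>2 \<noteq> 0) (at 0)" by (simp add: eventually_at_filter)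
  show "eventually (\<lambda>u::real. 2 * u \<noteq> 0) (at 0)" by (simp add: eventually_at_filter)
  have "((\<lambda>u. x + u) \<longlongrightarrow> x + 0) (at 0)" by (intro tendsto_intros)
  then have "eventually (\<lambda>u. x + u \<in> S) (at 0)" using S by (intro topological_tendstoD) auto
  then show "eventually (\<lambda>u. ((\<lambda>u. h (x + u) - h x - h' x * u) has_real_derivative h' (x + u) - h' x) (at u)) (at 0)"
    by eventually_elim (auto intro!: derivative_eq_intros DERIV_chain2[OF h])
  show "eventually (\<lambda>u::real. ((\<lambda>u. u\<^sup>2) has_real_derivative 2 * u) (at u)) (at 0)"
    by (intro always_eventually allI) (auto intro!: derivative_eq_intros)
  have "((\<lambda>u. (h' (x + u) - h' x) / u / 2) \<longlongrightarrow> D / 2) (at 0)"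
    using h' by (intro tendsto_divide tendsto_const) (simp_all add: DERIV_def)
  then show "((\<lambda>u. (h' (x + u) - h' x) / (2 * u)) \<longlongrightarrow> D / 2) (at 0)"
    by (simp add: mult.commute)
qed

text \<open>The small-time generator of Brownian motion, for a general noise law: mean zero removes
  the linear Taylor term and unit variance leaves \<open>h'' / 2\<close>. Convergence is dominated
  twice, by \<open>K * y\<^sup>2\<close> under the noise and by the constant \<open>K\<close> under
  \<pi>.\<close>

lemma second_order_expansion_of_smoothing:
  fixes h h' h'' s :: "_ \<Rightarrow> real"
  assumes "prob_space \<pi>" "prob_space \<mu>"
    and sets: "sets \<pi> = sets borel" "sets \<mu> = sets borel"
    and int1: "integrable \<mu> (\<lambda>y. y)" and mean: "(\<integral>y. y \<partial>\<mu>) = 0"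
    and int2: "integrable \<mu> (\<lambda>y. y\<^sup>2)" and var: "(\<integral>y. y\<^sup>2 \<partial>\<mu>) = 1"
    and h: "\<And>x. (h has_real_derivative h' x) (at x)" and H: "\<And>x. \<bar>h x\<bar> \<le> H"
    and lip: "\<And>x y. \<bar>h' x - h' y\<bar> \<le> K * \<bar>x - y\<bar>"
    and h': "AE x in \<pi>. (h' has_real_derivative h'' x) (at x)"
    and h''[measurable]: "h'' \<in> borel_measurable borel"
    and s: "s \<longlonglongrightarrow> 0" "\<And>n. 0 < s n"
  shows "(\<lambda>n. ((\<integral>x. \<integral>y. h (x + s n * y) \<partial>\<mu> \<partial>\<pi>) - (\<integral>x. h x \<partial>\<pi>)) / (s n)\<^sup>2) \<longlonglongrightarrow> (\<integral>x. h'' x \<partial>\<pi>) / 2"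
proof -
  interpret pi: prob_space \<pi> by fact
  interpret mu: prob_space \<mu> by fact
  note sets[measurable_cong]
  have K: "0 \<le> K" using lip[of 0 1] by simp
  have [measurable]: "h \<in> borel_measurable borel"
    using h by (intro borel_measurable_continuous_onI) (meson DERIV_isCont continuous_at_imp_continuous_on)
  have inth: "integrable \<mu> (\<lambda>y. h (x + s n * y))" for x n
    using H by (intro mu.integrable_const_bound[where B=H]) auto
  have inth2: "integrable \<pi> (\<lambda>x. \<integral>y. h (x + s n * y) \<partial>\<mu>)" for n
  proof (rule pi.integrable_const_bound[where B=H])
    show "AE x in \<pi>. norm (\<integral>y. h (x + s n * y) \<partial>\<mu>) \<le> H"
    proof (rule AE_I2)
      fix x
      have "norm (\<integral>y. h (x + s n * y) \<partial>\<mu>) \<le> (\<integral>y. H \<partial>\<mu>)"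
        by (rule Bochner_Integration.integral_norm_bound_integral) (use inth H in auto)
      then show "norm (\<integral>y. h (x + s n * y) \<partial>\<mu>) \<le> H" by (simp add: mu.prob_space)
    qed
  qed measurable
  have inth3: "integrable \<pi> h"
    using H by (intro pi.integrable_const_bound[where B=H]) auto
  \<comment> \<open>The linear term integrates to zero under \<mu>, so subtracting it leaves
    \<open>\<phi>\<close> unchanged but makes the quotient bounded by \<open>K * y\<^sup>2\<close>
    uniformly in \<open>n\<close>.\<close>
  define g where "g n x y = (h (x + s n * y) - h x - h' x * (s n * y)) / (s n)\<^sup>2" for n x y
  have g_bound: "\<bar>g n x y\<bar> \<le> K * y\<^sup>2" for n x y
    using lipschitz_derivative_remainder[OF h lip, of x "s n * y"] s(2)[of n]
    by (simp add: g_def field_simps)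
  have intg: "integrable \<mu> (g n x)" for n x
    unfolding g_def using inth int1 by (intro integrable_divide Bochner_Integration.integrable_diff) auto
  define \<phi> where "\<phi> n x = ((\<integral>y. h (x + s n * y) \<partial>\<mu>) - h x) / (s n)\<^sup>2" for n x
  have \<phi>_g: "\<phi> n x = (\<integral>y. g n x y \<partial>\<mu>)" for n x
    unfolding \<phi>_def g_def using inth int1 mean by (simp add: mu.prob_space)
  have \<phi>_bound: "norm (\<phi> n x) \<le> K" for n x
  proof -
    have "norm (\<phi> n x) \<le> (\<integral>y. K * y\<^sup>2 \<partial>\<mu>)"
      unfolding \<phi>_g by (rule Bochner_Integration.integral_norm_bound_integral) (use intg int2 g_bound in auto)
    then show ?thesis using var by simp
  qed
  have \<phi>_lim: "(\<lambda>n. \<phi> n x) \<longlonglongrightarrow> h'' x / 2" if x: "(h' has_real_derivative h'' x) (at x)" for x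
  proof -
    have "(\<lambda>n. \<integral>y. g n x y \<partial>\<mu>) \<longlonglongrightarrow> (\<integral>y. y\<^sup>2 * (h'' x / 2) \<partial>\<mu>)"
    proof (rule integral_dominated_convergence[where w="\<lambda>y. K * y\<^sup>2"])
      show "AE y in \<mu>. (\<lambda>n. g n x y) \<longlonglongrightarrow> y\<^sup>2 * (h'' x / 2)"
      proof (rule AE_I2)
        fix y
        show "(\<lambda>n. g n x y) \<longlonglongrightarrow> y\<^sup>2 * (h'' x / 2)"
        proof (cases "y = 0")
          case False
          have "(\<lambda>n. s n * y) \<longlonglongrightarrow> 0" using s(1) by (rule tendsto_mult_left_zero)
          then have "filterlim (\<lambda>n. s n * y) (at 0) sequentially"
            using s(2) False by (intro filterlim_atI) (auto simp: less_imp_neq[symmetric])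
          from filterlim_compose[OF second_order_difference_quotient[OF open_UNIV UNIV_I h x] this]
          have "(\<lambda>n. y\<^sup>2 * ((h (x + s n * y) - h x - h' x * (s n * y)) / (s n * y)\<^sup>2)) \<longlonglongrightarrow> y\<^sup>2 * (h'' x / 2)"
            by (intro tendsto_mult tendsto_const)
          moreover have "y\<^sup>2 * ((h (x + s n * y) - h x - h' x * (s n * y)) / (s n * y)\<^sup>2) = g n x y" for n
            using False s(2)[of n] by (simp add: g_def power_mult_distrib)
          ultimately show ?thesis by simp
        qed (simp add: g_def)
      qed
    qed (use intg g_bound int2 in auto)
    then show ?thesis using \<phi>_g var by simp
  qed
  have "(\<lambda>n. \<integral>x. \<phi> n x \<partial>\<pi>) \<longlonglongrightarrow> (\<integral>x. h'' x / 2 \<partial>\<pi>)"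
  proof (rule integral_dominated_convergence[where w="\<lambda>x. K"])
    show "AE x in \<pi>. (\<lambda>n. \<phi> n x) \<longlonglongrightarrow> h'' x / 2"
      using h' by eventually_elim (rule \<phi>_lim)
    show "\<phi> n \<in> borel_measurable \<pi>" for n unfolding \<phi>_def by measurable
  qed (use \<phi>_bound in auto)
  moreover have "(\<integral>x. \<phi> n x \<partial>\<pi>)
      = ((\<integral>x. \<integral>y. h (x + s n * y) \<partial>\<mu> \<partial>\<pi>) - (\<integral>x. h x \<partial>\<pi>)) / (s n)\<^sup>2" for n
    unfolding \<phi>_def using inth2 inth3 by simp
  ultimately show ?thesis by simp
qed

definition std_normal :: "real measure" where
  "std_normal = density lborel std_normal_density"

section \<open>The mispricing process at small times\<close>

context mispricing_process begin

lemma AE_regular_path: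
  "AE \<omega> in M. continuous_on {0..} (\<lambda>t. B t \<omega>) \<and> mono_on {0..} (\<lambda>t. N t \<omega>)
     \<and> (\<forall>t\<ge>0. continuous (at_right t) (\<lambda>s. N s \<omega>)) \<and> N 0 \<omega> = 0"
  using bm_continuous poisson_mono poisson_right_continuous poisson_start by eventually_elim blast

lemma AE_no_arrival:
  assumes "0 \<le> t"
  shows "AE \<omega> in M. N t \<omega> = 0 \<longrightarrow> z t \<omega> = z 0 \<omega> + \<sigma> * (B t \<omega> - B 0 \<omega>)"
  using AE_regular_path z_between_arrivals
proof eventually_elim
  case (elim \<omega>)
  show ?case
  proof
    assume "N t \<omega> = 0"
    then have "\<not> arrival_time (\<lambda>r. N r \<omega>) u" if "u \<in> {0<..t}" for u
      using no_arrival_time_if_no_increment[of "\<lambda>r. N r \<omega>" t u] elim(1) that by auto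
    then have "z t \<omega> - z 0 \<omega> = \<sigma> * (B t \<omega> - B 0 \<omega>)"
      using elim(2) assms by blast
    then show "z t \<omega> = z 0 \<omega> + \<sigma> * (B t \<omega> - B 0 \<omega>)" by simp
  qed
qed

lemma AE_single_arrival:
  assumes "0 \<le> t"
  shows "AE \<omega> in M. N t \<omega> = 1 \<longrightarrow> (\<exists>T. 0 < T \<and> T \<le> t \<and>
    z t \<omega> = arb_reset \<gamma> \<delta> (z 0 \<omega> + \<sigma> * (B T \<omega> - B 0 \<omega>)) + \<sigma> * (B t \<omega> - B T \<omega>))"
  using AE_regular_path z_between_arrivals z_at_arrivals
proof eventually_elim
  case (elim \<omega>)
  show ?case
  proof
    assume "N t \<omega> = 1"
    then have "N t \<omega> = Suc (N 0 \<omega>)" using elim(1) by simp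
    then obtain T where "0 < T" "T \<le> t"
      "z t \<omega> = arb_reset \<gamma> \<delta> (z 0 \<omega> + \<sigma> * (B T \<omega> - B 0 \<omega>)) + \<sigma> * (B t \<omega> - B T \<omega>)"
      by (rule path_with_single_arrival[of "\<lambda>t. B t \<omega>" "\<lambda>t. N t \<omega>" t "\<lambda>t. z t \<omega>" \<sigma> \<gamma> \<delta>, rotated 4])
         (use elim assms in auto)
    then show "\<exists>T. 0 < T \<and> T \<le> t \<and>
      z t \<omega> = arb_reset \<gamma> \<delta> (z 0 \<omega> + \<sigma> * (B T \<omega> - B 0 \<omega>)) + \<sigma> * (B t \<omega> - B T \<omega>)" by blast
  qed
qed

section \<open>Law of the arrival count and its independence of start and noise\<close>

lemma prob_count:
  assumes "0 < t"
  shows "prob {\<omega> \<in> space M. N t \<omega> = k} = (rate * t) ^ k / fact k * exp (- (rate * t))"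
proof -
  have [measurable]: "N t \<in> measurable M (count_space UNIV)" "N 0 \<in> measurable M (count_space UNIV)"
    using poisson_measurable assms by auto
  have "prob {\<omega> \<in> space M. N t \<omega> = k} = prob {\<omega> \<in> space M. N t \<omega> - N 0 \<omega> = k}"
    using poisson_start by (intro measure_eq_AE) auto
  also have "\<dots> = measure (distr M (count_space UNIV) (\<lambda>\<omega>. N t \<omega> - N 0 \<omega>)) {k}"
    by (subst measure_distr) (auto intro!: arg_cong[where f=prob])
  also have "\<dots> = pmf (poisson_pmf (rate * t)) k"
    using poisson_increments[of 0 t] assms by (simp add: pmf.rep_eq)
  finally show ?thesis using assms rate_pos by simp
qed

lemma expectation_count:
  assumes "0 < t"
  shows "(\<integral>\<omega>. of_bool (N t \<omega> = k) \<partial>M) = (rate * t) ^ k / fact k * exp (- (rate * t))"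
proof -
  have "(\<integral>\<omega>. of_bool (N t \<omega> = k) \<partial>M) = (\<integral>\<omega>. indicator {\<omega> \<in> space M. N t \<omega> = k} \<omega> \<partial>M)"
    by (intro Bochner_Integration.integral_cong) (auto simp: indicator_def)
  also have "\<dots> = prob {\<omega> \<in> space M. N t \<omega> = k}"
    using poisson_measurable[of t] assms by simp
  finally show ?thesis using prob_count[OF assms] by simp
qed

text \<open>Allowing \<open>F\<close> to depend on the whole Brownian path covers the endpoint of
  the noise, the reset of the start and the event of a large oscillation alike.\<close>

lemma start_and_noise_indep_count:
  assumes t: "0 \<le> t" and F: "F \<in> borel_measurable (borel \<Otimes>\<^sub>M (\<Pi>\<^sub>M t\<in>{0..}. borel))"
    and C: "\<And>u. \<bar>F u\<bar> \<le> (C::real)"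
  shows "(\<integral>\<omega>. F (z 0 \<omega>, full_path B \<omega>) * of_bool (N t \<omega> = k) \<partial>M)
    = (\<integral>\<omega>. F (z 0 \<omega>, full_path B \<omega>) \<partial>M) * (\<integral>\<omega>. of_bool (N t \<omega> = k) \<partial>M)"
proof -
  have ps: "prob_space M" by (rule prob_space_axioms)
  have ind: "indep_random_vars M (borel \<Otimes>\<^sub>M (\<Pi>\<^sub>M t\<in>{0..}. borel)) (\<lambda>\<omega>. (z 0 \<omega>, full_path B \<omega>))
      (\<Pi>\<^sub>M t\<in>{0..}. count_space UNIV) (full_path N)"
    using ps initial_independent brownian_poisson_independent by (rule indep_random_vars_assoc)
  have "(\<lambda>n. of_bool (n t = k) :: real) \<in> borel_measurable (\<Pi>\<^sub>M t\<in>{0..}. count_space (UNIV::nat set))"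
  proof -
    have [measurable]: "(\<lambda>n. n t) \<in> measurable (\<Pi>\<^sub>M t\<in>{0..}. count_space (UNIV::nat set)) (count_space UNIV)"
      using t by (intro measurable_component_singleton) auto
    show ?thesis by measurable
  qed
  from indep_var_if_indep_random_vars[OF ps indep_random_vars_compose[OF ps ind F this]]
  have "indep_var borel (\<lambda>\<omega>. F (z 0 \<omega>, full_path B \<omega>)) borel (\<lambda>\<omega>. of_bool (N t \<omega> = k) :: real)"
    using t by simp
  moreover have m: "(\<lambda>\<omega>. (z 0 \<omega>, full_path B \<omega>)) \<in> measurable M (borel \<Otimes>\<^sub>M (\<Pi>\<^sub>M t\<in>{0..}. borel))"
    using ind by (simp add: indep_random_vars_def)
  have "integrable M (\<lambda>\<omega>. F (z 0 \<omega>, full_path B \<omega>))"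
    using C measurable_compose[OF m F] by (intro integrable_const_bound[where B=C]) auto
  moreover have "integrable M (\<lambda>\<omega>. of_bool (N t \<omega> = k) :: real)"
    using poisson_measurable[OF t] by (intro integrable_const_bound[where B=1]) auto
  ultimately show ?thesis by (rule indep_var_lebesgue_integral)
qed

text \<open>The increment divided by \<open>sqrt t\<close> is standard normal and independent of
  \<open>z 0\<close>, so the joint law is a product and Fubini applies. This is the form that the
  second-order expansion takes as input.\<close>

lemma expectation_start_plus_noise:
  assumes t: "0 < t" and h[measurable]: "h \<in> borel_measurable borel" and H: "\<And>x. \<bar>h x\<bar> \<le> (H::real)"
  shows "(\<integral>\<omega>. h (z 0 \<omega> + \<sigma> * (B t \<omega> - B 0 \<omega>)) \<partial>M)
    = (\<integral>x. \<integral>y. h (x + \<sigma> * sqrt t * y) \<partial>std_normal \<partial>distr M borel (z 0))"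
proof -
  have ps: "prob_space M" by (rule prob_space_axioms)
  have [measurable]: "z 0 \<in> borel_measurable M" "B t \<in> borel_measurable M" "B 0 \<in> borel_measurable M"
    using z_measurable bm_measurable t by auto
  define Y where "Y \<omega> = (B t \<omega> - B 0 \<omega>) / sqrt t" for \<omega>
  have [measurable]: "Y \<in> borel_measurable M" unfolding Y_def by measurable
  have "distributed M lborel Y std_normal_density"
    using bm_gaussian[of 0 t] normal_standard_normal_convert[of "sqrt t" "\<lambda>\<omega>. B t \<omega> - B 0 \<omega>" 0] t
    unfolding Y_def by simp
  then have dY: "distr M borel Y = std_normal"
    unfolding distributed_def std_normal_def by (metis distr_cong sets_lborel)
  have "(\<lambda>(w, n). (w t - w 0) / sqrt t) \<in>
      borel_measurable ((\<Pi>\<^sub>M t\<in>{0..}. borel) \<Otimes>\<^sub>M (\<Pi>\<^sub>M t\<in>{0..}. count_space (UNIV::nat set)))"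
  proof -
    have [measurable]: "(\<lambda>w. w t) \<in> borel_measurable (\<Pi>\<^sub>M t\<in>{0..}. borel)"
      "(\<lambda>w. w 0) \<in> borel_measurable (\<Pi>\<^sub>M t\<in>{0::real..}. borel)"
      using t by (auto intro: measurable_component_singleton)
    show ?thesis by measurable
  qed
  from indep_random_vars_compose[OF ps initial_independent measurable_ident this]
  have "indep_random_vars M borel (z 0) borel Y"
    using t by (simp add: Y_def[abs_def])
  then have "indep_var borel (z 0) borel Y" by (rule indep_var_if_indep_random_vars[OF ps])
  then have law: "distr M (borel \<Otimes>\<^sub>M borel) (\<lambda>\<omega>. (z 0 \<omega>, Y \<omega>)) = distr M borel (z 0) \<Otimes>\<^sub>M std_normal"
    unfolding indep_var_distribution_eq dY by simp
  interpret D: prob_space "distr M borel (z 0)" by (rule prob_space_distr) simp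
  interpret S: prob_space std_normal unfolding dY[symmetric] by (rule prob_space_distr) simp
  interpret pair_prob_space "distr M borel (z 0)" std_normal ..
  have [measurable_cong]: "sets std_normal = sets borel" by (simp add: std_normal_def)
  have "(\<integral>\<omega>. h (z 0 \<omega> + \<sigma> * (B t \<omega> - B 0 \<omega>)) \<partial>M)
      = (\<integral>\<omega>. (\<lambda>(x, y). h (x + \<sigma> * sqrt t * y)) (z 0 \<omega>, Y \<omega>) \<partial>M)"
    using t by (simp add: Y_def)
  also have "\<dots> = (\<integral>u. (\<lambda>(x, y). h (x + \<sigma> * sqrt t * y)) u \<partial>distr M (borel \<Otimes>\<^sub>M borel) (\<lambda>\<omega>. (z 0 \<omega>, Y \<omega>)))"
    by (subst integral_distr) auto
  also have "\<dots> = (\<integral>x. \<integral>y. h (x + \<sigma> * sqrt t * y) \<partial>std_normal \<partial>distr M borel (z 0))"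
    unfolding law
  proof (subst integral_fst'[symmetric])
    show "integrable (distr M borel (z 0) \<Otimes>\<^sub>M std_normal) (\<lambda>(x, y). h (x + \<sigma> * sqrt t * y))"
      using H by (intro P.integrable_const_bound[where B=H]) auto
  qed simp
  finally show ?thesis .
qed

text \<open>Without an arrival \<open>z t\<close> is \<open>z 0\<close> plus independent Gaussian
  noise and charges no point. By stationarity an atom of \<pi> therefore weighs at most the
  probability of an arrival before \<open>t\<close>, which tends to 0 with \<open>t\<close>.\<close>

lemma stationary_no_atoms:
  assumes \<sigma>: "\<sigma> \<noteq> 0" and stat: "\<And>t. 0 \<le> t \<Longrightarrow> distr M borel (z t) = \<pi>"
  shows "measure \<pi> {c} = 0"
proof -
  have le: "measure \<pi> {c} \<le> 1 - exp (- (rate * t))" if t: "0 < t" for t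
  proof -
    have [measurable]: "z t \<in> borel_measurable M" "z 0 \<in> borel_measurable M"
      "B t \<in> borel_measurable M" "B 0 \<in> borel_measurable M" "N t \<in> measurable M (count_space UNIV)"
      using z_measurable bm_measurable poisson_measurable t by auto
    have "AE y in std_normal. indicator {c} (x + \<sigma> * sqrt t * y) = (0::real)" for x
    proof -
      have "AE y in lborel. y \<noteq> (c - x) / (\<sigma> * sqrt t)" by (rule AE_lborel_singleton)
      then have "AE y in lborel. indicator {c} (x + \<sigma> * sqrt t * y) = (0::real)"
        by eventually_elim (use \<sigma> t in \<open>auto simp: field_simps indicator_def\<close>)
      then show ?thesis unfolding std_normal_def by (subst AE_density) auto
    qed
    then have "(\<integral>y. indicator {c} (x + \<sigma> * sqrt t * y) \<partial>std_normal) = (0::real)" for x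
      by (subst integral_cong_AE[where g="\<lambda>_. 0"]) (auto simp: std_normal_def)
    then have zero: "(\<integral>\<omega>. indicator {c} (z 0 \<omega> + \<sigma> * (B t \<omega> - B 0 \<omega>)) \<partial>M) = (0::real)"
      using t by (subst expectation_start_plus_noise[where H=1]) (auto simp: indicator_def)
    then have 0: "prob {\<omega> \<in> space M. z 0 \<omega> + \<sigma> * (B t \<omega> - B 0 \<omega>) = c} = 0"
    proof -
      have "(\<integral>\<omega>. indicator {c} (z 0 \<omega> + \<sigma> * (B t \<omega> - B 0 \<omega>)) \<partial>M)
          = (\<integral>\<omega>. indicator {\<omega> \<in> space M. z 0 \<omega> + \<sigma> * (B t \<omega> - B 0 \<omega>) = c} \<omega> \<partial>M :: real)"
        by (intro Bochner_Integration.integral_cong) (auto simp: indicator_def)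
      with zero show ?thesis by simp
    qed
    have "measure \<pi> {c} = prob {\<omega> \<in> space M. z t \<omega> = c}"
      unfolding stat[of t, symmetric, OF less_imp_le[OF t]]
      by (subst measure_distr) (auto intro!: arg_cong[where f=prob])
    also have "\<dots> \<le> prob ({\<omega> \<in> space M. N t \<omega> \<noteq> 0} \<union> {\<omega> \<in> space M. z 0 \<omega> + \<sigma> * (B t \<omega> - B 0 \<omega>) = c})"
      using AE_no_arrival[of t] t by (intro finite_measure_mono_AE) auto
    also have "\<dots> \<le> prob {\<omega> \<in> space M. N t \<omega> \<noteq> 0} + prob {\<omega> \<in> space M. z 0 \<omega> + \<sigma> * (B t \<omega> - B 0 \<omega>) = c}"
      by (rule measure_Un_le) auto
    also have "prob {\<omega> \<in> space M. N t \<omega> \<noteq> 0} = 1 - prob {\<omega> \<in> space M. N t \<omega> = 0}"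
      by (rule prob_neg) simp
    finally show ?thesis using 0 prob_count[OF t, of 0] by simp
  qed
  have "(\<lambda>n. 1 - exp (- (rate * (1 / real (Suc n))))) \<longlonglongrightarrow> 1 - exp (- (rate * 0))"
    by (intro tendsto_intros LIMSEQ_Suc[OF lim_1_over_n])
  then have "measure \<pi> {c} \<le> 1 - exp (- (rate * 0))"
    by (rule LIMSEQ_le_const) (intro exI allI impI le, simp)
  then show ?thesis using measure_nonneg[of \<pi> "{c}"] by simp
qed

end

text \<open>Countably many times control the whole path, so the oscillation event is measurable in
  the product sigma-algebra. Approaching \<open>s\<close> from the left keeps the rational times
  inside \<open>{0..t}\<close>.\<close>

lemma continuous_on_bound_rational_dense:
  fixes b :: "real \<Rightarrow> real"
  assumes b: "continuous_on {0..} b" and le: "\<And>q. q \<in> \<rat> \<Longrightarrow> 0 \<le> q \<Longrightarrow> q \<le> t \<Longrightarrow> \<bar>b q - b 0\<bar> \<le> c"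
    and s: "0 < s" "s \<le> t"
  shows "\<bar>b s - b 0\<bar> \<le> c"
proof (rule ccontr)
  assume "\<not> \<bar>b s - b 0\<bar> \<le> c"
  then have c: "c < \<bar>b s - b 0\<bar>" by simp
  have "(b \<longlongrightarrow> b s) (at s)"
    using b s(1) by (metis continuous_on_interior isContD interior_real_atLeast greaterThan_iff)
  then have "((\<lambda>u. \<bar>b u - b 0\<bar>) \<longlongrightarrow> \<bar>b s - b 0\<bar>) (at_left s)"
    by (intro tendsto_intros) (auto intro: tendsto_within_subset)
  from order_tendstoD(1)[OF this c]
  obtain a where a: "a < s" "\<And>y. y > a \<Longrightarrow> y < s \<Longrightarrow> c < \<bar>b y - b 0\<bar>"
    by (auto simp: eventually_at_left_field)
  obtain q where "q \<in> \<rat>" "max a 0 < q" "q < s"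
    using Rats_dense_in_real[of "max a 0" s] a(1) s(1) by auto
  then show False using a(2)[of q] le[of q] s by auto
qed

context mispricing_process begin

text \<open>The path is controlled on all of \<open>{0..t}\<close>, hence at the arrival, wherever
  it falls. Displacements are at most \<open>\<epsilon> / 2\<close>, and three of them enter (one
  through the reset, two through the increment after it), which \<open>2 * \<epsilon>\<close>
  covers; the distance to the barriers in the minimum prevents a crossing.\<close>

lemma AE_reset_error:
  assumes pos: "0 < \<sigma>" "0 < \<gamma>" "0 < \<delta>" and t: "0 < t"
  shows "AE \<omega> in M. N t \<omega> = 1 \<longrightarrow>
    (\<forall>q\<in>{q \<in> \<rat>. 0 \<le> q \<and> q \<le> t}. 2 * \<sigma> * \<bar>B q \<omega> - B 0 \<omega>\<bar> \<le> min \<epsilon> \<bar>\<bar>z 0 \<omega>\<bar> - (\<gamma> + \<delta>)\<bar>) \<longrightarrow>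
    \<bar>z 0 \<omega>\<bar> \<noteq> \<gamma> + \<delta> \<longrightarrow> \<bar>z t \<omega> - arb_reset \<gamma> \<delta> (z 0 \<omega>)\<bar> \<le> 2 * \<epsilon>"
  using AE_regular_path AE_single_arrival[OF less_imp_le[OF t]]
proof eventually_elim
  case (elim \<omega>)
  show ?case
  proof (intro impI)
    assume n: "N t \<omega> = 1" and ne: "\<bar>z 0 \<omega>\<bar> \<noteq> \<gamma> + \<delta>"
      and le: "\<forall>q\<in>{q \<in> \<rat>. 0 \<le> q \<and> q \<le> t}. 2 * \<sigma> * \<bar>B q \<omega> - B 0 \<omega>\<bar> \<le> min \<epsilon> \<bar>\<bar>z 0 \<omega>\<bar> - (\<gamma> + \<delta>)\<bar>"
    obtain T where T: "0 < T" "T \<le> t"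
      "z t \<omega> = arb_reset \<gamma> \<delta> (z 0 \<omega> + \<sigma> * (B T \<omega> - B 0 \<omega>)) + \<sigma> * (B t \<omega> - B T \<omega>)"
      using elim n by blast
    have bd: "2 * (\<sigma> * \<bar>B s \<omega> - B 0 \<omega>\<bar>) \<le> min \<epsilon> \<bar>\<bar>z 0 \<omega>\<bar> - (\<gamma> + \<delta>)\<bar>" if "0 < s" "s \<le> t" for s
    proof -
      have "\<bar>B s \<omega> - B 0 \<omega>\<bar> \<le> min \<epsilon> \<bar>\<bar>z 0 \<omega>\<bar> - (\<gamma> + \<delta>)\<bar> / (2 * \<sigma>)"
        by (rule continuous_on_bound_rational_dense[of "\<lambda>s. B s \<omega>" t])
           (use elim le pos that in \<open>auto simp: field_simps\<close>)
      then show ?thesis using pos(1) by (simp add: field_simps)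
    qed
    define u where "u = \<sigma> * (B T \<omega> - B 0 \<omega>)"
    have au: "\<bar>u\<bar> = \<sigma> * \<bar>B T \<omega> - B 0 \<omega>\<bar>" using pos(1) by (simp add: u_def abs_mult)
    have at: "\<bar>\<sigma> * (B t \<omega> - B 0 \<omega>)\<bar> = \<sigma> * \<bar>B t \<omega> - B 0 \<omega>\<bar>" using pos(1) by (simp add: abs_mult)
    have "\<bar>arb_reset \<gamma> \<delta> (z 0 \<omega> + u) - arb_reset \<gamma> \<delta> (z 0 \<omega>)\<bar> \<le> \<bar>u\<bar>"
      using bd[OF T(1,2)] au by (intro arb_reset_perturb pos ne) simp
    moreover have "z t \<omega> = arb_reset \<gamma> \<delta> (z 0 \<omega> + u) + (\<sigma> * (B t \<omega> - B 0 \<omega>) - u)"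
      unfolding T(3) u_def by (simp add: algebra_simps)
    ultimately show "\<bar>z t \<omega> - arb_reset \<gamma> \<delta> (z 0 \<omega>)\<bar> \<le> 2 * \<epsilon>"
      using bd[OF T(1,2)] bd[OF t order_refl] au at by linarith
  qed
qed

text \<open>Expands \<open>E[h (z t)] = E[h (z 0)]\<close> to first order in \<open>t\<close> by splitting on zero, one or more
  arrivals. On one arrival, \<open>z t\<close> is close to the reset of \<open>z 0\<close> unless \<open>B\<close> moves further than the distance of \<open>z 0\<close> to the barriers;
  that event depends on \<open>(z 0, B)\<close> alone, so it is independent of \<open>N t\<close>.\<close>

theorem stationary_generator_identity:
  fixes h h' h'' :: "real \<Rightarrow> real"
  assumes pos: "0 < \<sigma>" "0 < \<gamma>" "0 < \<delta>"
    and stat: "\<And>t. 0 \<le> t \<Longrightarrow> distr M borel (z t) = \<pi>"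
    and h: "\<And>x. (h has_real_derivative h' x) (at x)" and H: "\<And>x. \<bar>h x\<bar> \<le> H"
    and lip: "\<And>x y. \<bar>h x - h y\<bar> \<le> K * \<bar>x - y\<bar>"
    and lip': "\<And>x y. \<bar>h' x - h' y\<bar> \<le> K' * \<bar>x - y\<bar>"
    and h': "\<And>x. \<bar>x\<bar> \<noteq> \<gamma> + \<delta> \<Longrightarrow> (h' has_real_derivative h'' x) (at x)"
    and h''[measurable]: "h'' \<in> borel_measurable borel"
  shows "\<sigma>\<^sup>2 / 2 * (\<integral>x. h'' x \<partial>\<pi>) + rate * ((\<integral>x. h (arb_reset \<gamma> \<delta> x) \<partial>\<pi>) - (\<integral>x. h x \<partial>\<pi>)) = 0"
proof -
  have z[measurable]: "z t \<in> borel_measurable M" if "0 \<le> t" for t using z_measurable that .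
  have z0[measurable]: "z 0 \<in> borel_measurable M" by simp
  have [measurable]: "h \<in> borel_measurable borel"
    using h by (intro borel_measurable_continuous_onI) (meson DERIV_isCont continuous_at_imp_continuous_on)
  have \<pi>: "\<pi> = distr M borel (z 0)" using stat[of 0] by simp
  have sets[measurable_cong]: "sets \<pi> = sets borel" by (simp add: \<pi>)
  interpret P: prob_space \<pi> unfolding \<pi> by (rule prob_space_distr) simp
  have nonatomic: "AE x in \<pi>. \<bar>x\<bar> \<noteq> \<gamma> + \<delta>"
  proof -
    have "AE x in \<pi>. x \<noteq> c" for c
    proof -
      have "{c} \<in> null_sets \<pi>"
        using stationary_no_atoms[OF _ stat, of c] pos(1)
        by (intro null_setsI) (simp_all add: P.emeasure_eq_measure sets)
      from AE_not_in[OF this] show ?thesis by simp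
    qed
    from this[of "\<gamma> + \<delta>"] this[of "- (\<gamma> + \<delta>)"] show ?thesis by eventually_elim auto
  qed
  then have nonatomic0: "AE \<omega> in M. \<bar>z 0 \<omega>\<bar> \<noteq> \<gamma> + \<delta>"
    unfolding \<pi> by (subst (asm) AE_distr_iff) auto
  define t where "t n = 1 / real (Suc n)" for n
  have t: "0 < t n" for n by (simp add: t_def)
  have t0: "t \<longlonglongrightarrow> 0" unfolding t_def by (rule LIMSEQ_Suc[OF lim_1_over_n])
  define m where "m = (\<integral>x. h x \<partial>\<pi>)"
  define R where "R = (\<integral>x. h (arb_reset \<gamma> \<delta> x) \<partial>\<pi>)"
  define I where "I = (\<integral>x. h'' x \<partial>\<pi>)"
  define Q where "Q n = (\<integral>\<omega>. h (z 0 \<omega> + \<sigma> * (B (t n) \<omega> - B 0 \<omega>)) \<partial>M)" for n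
  define p where "p n k = (\<integral>\<omega>. of_bool (N (t n) \<omega> = k) \<partial>M :: real)" for n and k :: nat
  have p: "p n k = (rate * t n) ^ k / fact k * exp (- (rate * t n))" for n k
    unfolding p_def using expectation_count[OF t] .
  \<comment> \<open>Noise of scale \<open>\<sigma> * sqrt (t n)\<close> has variance
    \<open>\<sigma>\<^sup>2 * t n\<close>, so the second-order expansion in the scale is first order
    in time.\<close>
  have Qlim: "(\<lambda>n. (Q n - m) / t n) \<longlonglongrightarrow> \<sigma>\<^sup>2 / 2 * I"
  proof -
    have "(\<lambda>n. ((\<integral>x. \<integral>y. h (x + \<sigma> * sqrt (t n) * y) \<partial>std_normal \<partial>\<pi>) - (\<integral>x. h x \<partial>\<pi>)) / (\<sigma> * sqrt (t n))\<^sup>2)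
        \<longlonglongrightarrow> (\<integral>x. h'' x \<partial>\<pi>) / 2"
    proof (rule second_order_expansion_of_smoothing[OF _ _ sets _ _ _ _ _ h H lip' _ h''])
      show "prob_space std_normal" unfolding std_normal_def by (rule prob_space_normal_density) simp
      show "integrable std_normal (\<lambda>y. y)" "(\<integral>y. y \<partial>std_normal) = 0"
        using integrable_std_normal_moment[of 1] integral_std_normal_moment_odd[of 0]
        by (simp_all add: std_normal_def integrable_density integral_density)
      show "integrable std_normal (\<lambda>y. y\<^sup>2)" "(\<integral>y. y\<^sup>2 \<partial>std_normal) = 1"
        using integrable_std_normal_moment[of 2] integral_std_normal_moment_even[of 1]
        by (simp_all add: std_normal_def integrable_density integral_density fact_numeral)
      show "AE x in \<pi>. (h' has_real_derivative h'' x) (at x)"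
        using nonatomic by eventually_elim (rule h')
      have "(\<lambda>n. \<sigma> * sqrt (t n)) \<longlonglongrightarrow> \<sigma> * sqrt 0" using t0 by (intro tendsto_intros)
      then show "(\<lambda>n. \<sigma> * sqrt (t n)) \<longlonglongrightarrow> 0" by simp
      show "0 < \<sigma> * sqrt (t n)" for n using pos t by simp
    qed (rule P.prob_space_axioms, simp add: std_normal_def)
    then have "(\<lambda>n. \<sigma>\<^sup>2 * ((Q n - m) / (\<sigma> * sqrt (t n))\<^sup>2)) \<longlonglongrightarrow> \<sigma>\<^sup>2 * (I / 2)"
      unfolding Q_def m_def I_def expectation_start_plus_noise[OF t \<open>h \<in> borel_measurable borel\<close> H] \<pi>[symmetric]
      by (intro tendsto_mult tendsto_const)
    moreover have "\<sigma>\<^sup>2 * ((Q n - m) / (\<sigma> * sqrt (t n))\<^sup>2) = (Q n - m) / t n" for n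
      using pos t[of n] by (simp add: power_mult_distrib)
    ultimately show ?thesis by simp
  qed
  \<comment> \<open>The event that the path moves little compared with both \<epsilon> and the
    distance of the start to the barriers. Rational times keep it measurable.\<close>
  define G where "G n \<epsilon> = (\<lambda>(x, w). \<forall>q\<in>{q \<in> \<rat>. 0 \<le> q \<and> q \<le> t n}.
      2 * \<sigma> * \<bar>w q - w 0\<bar> \<le> min \<epsilon> \<bar>\<bar>x\<bar> - (\<gamma> + \<delta>)\<bar>)" for n and \<epsilon> :: real
  have G[measurable]: "Measurable.pred (borel \<Otimes>\<^sub>M (\<Pi>\<^sub>M t\<in>{0::real..}. borel)) (G n \<epsilon>)" for n \<epsilon>
  proof -
    have [measurable]: "(\<lambda>w. w q) \<in> borel_measurable (\<Pi>\<^sub>M t\<in>{0::real..}. borel :: real measure)" if "0 \<le> q" for q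
      using that by (intro measurable_component_singleton) auto
    have "Measurable.pred (borel \<Otimes>\<^sub>M (\<Pi>\<^sub>M t\<in>{0::real..}. borel))
        (\<lambda>u. \<forall>q\<in>{q \<in> \<rat>. 0 \<le> q \<and> q \<le> t n}. 2 * \<sigma> * \<bar>snd u q - snd u 0\<bar> \<le> min \<epsilon> \<bar>\<bar>fst u\<bar> - (\<gamma> + \<delta>)\<bar>)"
      unfolding pred_def
    proof (rule sets.sets_Collect_countable_All')
      show "countable {q \<in> \<rat>. 0 \<le> q \<and> q \<le> t n}" by (rule countable_subset[OF _ countable_rat]) auto
      fix q assume "q \<in> {q \<in> \<rat>. 0 \<le> q \<and> q \<le> t n}"
      then have [measurable]: "(\<lambda>w. w q) \<in> borel_measurable (\<Pi>\<^sub>M t\<in>{0::real..}. borel :: real measure)"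
        "(\<lambda>w. w 0) \<in> borel_measurable (\<Pi>\<^sub>M t\<in>{0::real..}. borel :: real measure)"
        by (auto intro!: measurable_component_singleton)
      show "{u \<in> space (borel \<Otimes>\<^sub>M (\<Pi>\<^sub>M t\<in>{0::real..}. borel)).
          2 * \<sigma> * \<bar>snd u q - snd u 0\<bar> \<le> min \<epsilon> \<bar>\<bar>fst u\<bar> - (\<gamma> + \<delta>)\<bar>}
          \<in> sets (borel \<Otimes>\<^sub>M (\<Pi>\<^sub>M t\<in>{0::real..}. borel))" by measurable
    qed
    then show ?thesis by (simp add: G_def case_prod_unfold)
  qed
  have mU: "(\<lambda>\<omega>. (z 0 \<omega>, full_path B \<omega>)) \<in> measurable M (borel \<Otimes>\<^sub>M (\<Pi>\<^sub>M t\<in>{0::real..}. borel))"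
    using brownian_poisson_independent by (auto simp: indep_random_vars_def)
  have G_path: "G n \<epsilon> (z 0 \<omega>, full_path B \<omega>) \<longleftrightarrow> (\<forall>q\<in>{q \<in> \<rat>. 0 \<le> q \<and> q \<le> t n}.
      2 * \<sigma> * \<bar>B q \<omega> - B 0 \<omega>\<bar> \<le> min \<epsilon> \<bar>\<bar>z 0 \<omega>\<bar> - (\<gamma> + \<delta>)\<bar>)" for n \<epsilon> \<omega>
    by (simp add: G_def)
  define b where "b n \<epsilon> = (\<integral>\<omega>. of_bool (\<not> G n \<epsilon> (z 0 \<omega>, full_path B \<omega>)) \<partial>M :: real)" for n \<epsilon>
  \<comment> \<open>Almost every path is continuous at 0 and almost every start lies off the
    barriers, so the allowed displacement is positive and is eventually respected.\<close>
  have blim: "(\<lambda>n. b n \<epsilon>) \<longlonglongrightarrow> 0" if \<epsilon>: "0 < \<epsilon>" for \<epsilon>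
  proof -
    have "(\<lambda>n. b n \<epsilon>) \<longlonglongrightarrow> (\<integral>\<omega>. 0 \<partial>M)"
      unfolding b_def
    proof (rule integral_dominated_convergence[where w="\<lambda>_. 1"])
      show "AE \<omega> in M. (\<lambda>n. of_bool (\<not> G n \<epsilon> (z 0 \<omega>, full_path B \<omega>)) :: real) \<longlonglongrightarrow> 0"
        using AE_regular_path nonatomic0
      proof eventually_elim
        case (elim \<omega>)
        define c where "c = min \<epsilon> \<bar>\<bar>z 0 \<omega>\<bar> - (\<gamma> + \<delta>)\<bar>"
        have "0 < c / (2 * \<sigma>)" using elim(2) \<epsilon> pos by (simp add: c_def)
        moreover have "continuous (at 0 within {0..}) (\<lambda>t. B t \<omega>)"
          using elim(1) by (simp add: continuous_on_eq_continuous_within)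
        ultimately obtain d where "0 < d"
          and "\<forall>s\<in>{0..}. dist s 0 < d \<longrightarrow> dist (B s \<omega>) (B 0 \<omega>) < c / (2 * \<sigma>)"
          unfolding continuous_within_eps_delta by blast
        then have d: "0 < d" "\<And>s. 0 \<le> s \<Longrightarrow> s < d \<Longrightarrow> \<bar>B s \<omega> - B 0 \<omega>\<bar> < c / (2 * \<sigma>)"
          by (auto simp: dist_real_def)
        have "eventually (\<lambda>n. t n < d) sequentially" using order_tendstoD(2)[OF t0 d(1)] .
        then have "eventually (\<lambda>n. of_bool (\<not> G n \<epsilon> (z 0 \<omega>, full_path B \<omega>)) = (0::real)) sequentially"
        proof eventually_elim
          case (elim n)
          have "2 * \<sigma> * \<bar>B q \<omega> - B 0 \<omega>\<bar> \<le> c" if "0 \<le> q" "q \<le> t n" for q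
            using d(2)[of q] that elim pos(1) by (simp add: field_simps)
          then show ?case unfolding G_path c_def by auto
        qed
        then show ?case by (rule tendsto_eventually)
      qed
    qed (use measurable_compose[OF mU G] in \<open>auto\<close>)
    then show ?thesis by simp
  qed
  have K: "0 \<le> K" using lip[of 0 1] by simp
  have H0: "0 \<le> H" using H[of 0] by simp
  \<comment> \<open>The error has three sources: one arrival with small oscillation costs
    \<open>2 * K * \<epsilon>\<close> by the Lipschitz bound, one arrival with large oscillation
    costs \<open>2 * H\<close>, two or more arrivals cost \<open>H\<close>. Without arrival there is
    no error.\<close>
  have bound: "\<bar>m - p n 0 * Q n - p n 1 * R\<bar>
      \<le> p n 1 * (2 * K * \<epsilon> + 2 * H * b n \<epsilon>) + H * (1 - p n 0 - p n 1)" if \<epsilon>: "0 < \<epsilon>" for n \<epsilon>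
  proof -
    have tn: "0 \<le> t n" using t[of n] by simp
    have [measurable]: "N (t n) \<in> measurable M (count_space UNIV)" "z (t n) \<in> borel_measurable M"
      "B (t n) \<in> borel_measurable M" "B 0 \<in> borel_measurable M"
      using poisson_measurable bm_measurable tn by auto
    have [measurable]: "(\<lambda>w. w (t n)) \<in> borel_measurable (\<Pi>\<^sub>M t\<in>{0::real..}. borel :: real measure)"
      "(\<lambda>w. w 0) \<in> borel_measurable (\<Pi>\<^sub>M t\<in>{0::real..}. borel :: real measure)"
      using tn by (auto intro: measurable_component_singleton)
    have [measurable]: "Measurable.pred M (\<lambda>\<omega>. G n \<epsilon> (z 0 \<omega>, full_path B \<omega>))"
      using measurable_compose[OF mU G] .
    have e0: "(\<integral>\<omega>. h (z 0 \<omega> + \<sigma> * (B (t n) \<omega> - B 0 \<omega>)) * of_bool (N (t n) \<omega> = 0) \<partial>M) = Q n * p n 0"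
      using start_and_noise_indep_count[OF tn, where F="\<lambda>(x, w). h (x + \<sigma> * (w (t n) - w 0))" and C=H and k=0] tn H
      by (simp add: Q_def p_def split_beta)
    have e1: "(\<integral>\<omega>. h (arb_reset \<gamma> \<delta> (z 0 \<omega>)) * of_bool (N (t n) \<omega> = 1) \<partial>M) = R * p n 1"
      using start_and_noise_indep_count[OF tn, where F="\<lambda>(x, w). h (arb_reset \<gamma> \<delta> x)" and C=H and k=1] H
      by (simp add: R_def p_def \<pi> integral_distr split_beta)
    have e2: "(\<integral>\<omega>. of_bool (\<not> G n \<epsilon> (z 0 \<omega>, full_path B \<omega>)) * of_bool (N (t n) \<omega> = 1) \<partial>M) = b n \<epsilon> * p n 1"
      using start_and_noise_indep_count[OF tn, where F="\<lambda>u. of_bool (\<not> G n \<epsilon> u)" and C=1 and k=1]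
      by (simp add: b_def p_def)
    have em: "(\<integral>\<omega>. h (z (t n) \<omega>) \<partial>M) = m"
      unfolding m_def stat[OF tn, symmetric] by (simp add: integral_distr)
    have i0: "integrable M (\<lambda>\<omega>. h (z (t n) \<omega>))"
      "integrable M (\<lambda>\<omega>. h (z 0 \<omega> + \<sigma> * (B (t n) \<omega> - B 0 \<omega>)) * of_bool (N (t n) \<omega> = 0))"
      "integrable M (\<lambda>\<omega>. h (arb_reset \<gamma> \<delta> (z 0 \<omega>)) * of_bool (N (t n) \<omega> = 1))"
      using H H0 by (auto intro!: integrable_const_bound[where B=H] split: split_of_bool)
    have i1: "integrable M (\<lambda>\<omega>. of_bool (\<not> G n \<epsilon> (z 0 \<omega>, full_path B \<omega>)) * of_bool (N (t n) \<omega> = 1) :: real)"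
      "integrable M (\<lambda>\<omega>. of_bool (N (t n) \<omega> = k) :: real)" for k
      by (auto intro!: integrable_const_bound[where B=1])
    define f where "f \<omega> = h (z (t n) \<omega>) - h (z 0 \<omega> + \<sigma> * (B (t n) \<omega> - B 0 \<omega>)) * of_bool (N (t n) \<omega> = 0)
        - h (arb_reset \<gamma> \<delta> (z 0 \<omega>)) * of_bool (N (t n) \<omega> = 1)" for \<omega>
    define g where "g \<omega> = 2 * K * \<epsilon> * of_bool (N (t n) \<omega> = 1)
        + 2 * H * (of_bool (\<not> G n \<epsilon> (z 0 \<omega>, full_path B \<omega>)) * of_bool (N (t n) \<omega> = 1))
        + H * (1 - of_bool (N (t n) \<omega> = 0) - of_bool (N (t n) \<omega> = 1))" for \<omega>
    have if_: "integrable M f" and ig: "integrable M g"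
      unfolding f_def[abs_def] g_def[abs_def] using i0 i1
      by (auto intro!: Bochner_Integration.integrable_diff Bochner_Integration.integrable_add integrable_mult_right)
    have Ef: "(\<integral>\<omega>. f \<omega> \<partial>M) = m - p n 0 * Q n - p n 1 * R"
      unfolding f_def using i0 e0 e1 em by simp
    have Eg: "(\<integral>\<omega>. g \<omega> \<partial>M) = p n 1 * (2 * K * \<epsilon> + 2 * H * b n \<epsilon>) + H * (1 - p n 0 - p n 1)"
      unfolding g_def using i1 e2 by (simp add: p_def[symmetric] prob_space algebra_simps)
    have "AE \<omega> in M. \<bar>f \<omega>\<bar> \<le> g \<omega>"
      using AE_no_arrival[OF tn] AE_reset_error[OF pos t[of n], of \<epsilon>] nonatomic0
    proof eventually_elim
      case (elim \<omega>)
      consider "N (t n) \<omega> = 0" | "N (t n) \<omega> = 1" "G n \<epsilon> (z 0 \<omega>, full_path B \<omega>)"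
        | "N (t n) \<omega> = 1" "\<not> G n \<epsilon> (z 0 \<omega>, full_path B \<omega>)"
        | "N (t n) \<omega> \<noteq> 0" "N (t n) \<omega> \<noteq> 1" by blast
      then show ?case
      proof cases
        case 1
        then show ?thesis using elim(1) by (simp add: f_def g_def)
      next
        case 2
        have "\<bar>z (t n) \<omega> - arb_reset \<gamma> \<delta> (z 0 \<omega>)\<bar> \<le> 2 * \<epsilon>"
          using elim(2,3) 2 unfolding G_path by blast
        then have "K * \<bar>z (t n) \<omega> - arb_reset \<gamma> \<delta> (z 0 \<omega>)\<bar> \<le> K * (2 * \<epsilon>)"
          using K by (rule mult_left_mono)
        then show ?thesis
          using 2 lip[of "z (t n) \<omega>" "arb_reset \<gamma> \<delta> (z 0 \<omega>)"] by (simp add: f_def g_def)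
      next
        case 3
        have "0 \<le> K * \<epsilon>" using K \<epsilon> by simp
        then show ?thesis
          using 3 H[of "z (t n) \<omega>"] H[of "arb_reset \<gamma> \<delta> (z 0 \<omega>)"] by (simp add: f_def g_def)
      next
        case 4
        then show ?thesis using H[of "z (t n) \<omega>"] by (simp add: f_def g_def)
      qed
    qed
    then have "(\<integral>\<omega>. \<bar>f \<omega>\<bar> \<partial>M) \<le> (\<integral>\<omega>. g \<omega> \<partial>M)"
      using if_ ig by (intro integral_mono_AE) auto
    then show ?thesis
      using integral_abs_bound[of M f] unfolding Ef Eg by linarith
  qed
  \<comment> \<open>The negative of the left side of the claim, and the limit of the bounded error
    divided by \<open>t n\<close>.\<close>
  define X where "X = rate * m - \<sigma>\<^sup>2 / 2 * I - rate * R"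
  have tat: "filterlim t (at_right 0) sequentially"
    using t0 t by (intro tendsto_imp_filterlim_at_right) auto
  have lim0: "(\<lambda>n. (1 - p n 0) / t n) \<longlonglongrightarrow> rate" "(\<lambda>n. p n 0) \<longlonglongrightarrow> 1"
    and lim1: "(\<lambda>n. p n 1 / t n) \<longlonglongrightarrow> rate"
    and lim2: "(\<lambda>n. (1 - p n 0 - p n 1) / t n) \<longlonglongrightarrow> 0"
  proof -
    have "((\<lambda>t. (1 - exp (- (rate * t))) / t) \<longlongrightarrow> rate) (at_right 0)" using rate_pos by real_asymp
    from filterlim_compose[OF this tat] show "(\<lambda>n. (1 - p n 0) / t n) \<longlonglongrightarrow> rate" by (simp add: p)
    have "((\<lambda>t. exp (- (rate * t))) \<longlongrightarrow> 1) (at_right 0)" using rate_pos by real_asymp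
    from filterlim_compose[OF this tat] show "(\<lambda>n. p n 0) \<longlonglongrightarrow> 1" by (simp add: p)
    have "((\<lambda>t. rate * t * exp (- (rate * t)) / t) \<longlongrightarrow> rate) (at_right 0)" using rate_pos by real_asymp
    from filterlim_compose[OF this tat] show "(\<lambda>n. p n 1 / t n) \<longlonglongrightarrow> rate" by (simp add: p)
    have "((\<lambda>t. (1 - exp (- (rate * t)) - rate * t * exp (- (rate * t))) / t) \<longlongrightarrow> 0) (at_right 0)"
      using rate_pos by real_asymp
    from filterlim_compose[OF this tat] show "(\<lambda>n. (1 - p n 0 - p n 1) / t n) \<longlonglongrightarrow> 0" by (simp add: p)
  qed
  \<comment> \<open>For fixed \<epsilon> first \<open>n\<close> tends to infinity: multiple arrivals
    have probability \<open>o(t)\<close> and \<open>b n \<epsilon>\<close> vanishes. Only afterwards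
    is \<epsilon> made small.\<close>
  have small: "\<bar>X\<bar> \<le> rate * (2 * K * \<epsilon>)" if \<epsilon>: "0 < \<epsilon>" for \<epsilon>
  proof -
    have L: "(\<lambda>n. \<bar>(1 - p n 0) / t n * m - p n 0 * ((Q n - m) / t n) - p n 1 / t n * R\<bar>)
        \<longlonglongrightarrow> \<bar>rate * m - 1 * (\<sigma>\<^sup>2 / 2 * I) - rate * R\<bar>"
      by (intro tendsto_intros lim0 lim1 Qlim)
    have U: "(\<lambda>n. p n 1 / t n * (2 * K * \<epsilon> + 2 * H * b n \<epsilon>) + H * ((1 - p n 0 - p n 1) / t n))
        \<longlonglongrightarrow> rate * (2 * K * \<epsilon> + 2 * H * 0) + H * 0"
      by (intro tendsto_intros lim1 lim2 blim \<epsilon>)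
    have "\<bar>(1 - p n 0) / t n * m - p n 0 * ((Q n - m) / t n) - p n 1 / t n * R\<bar>
        \<le> p n 1 / t n * (2 * K * \<epsilon> + 2 * H * b n \<epsilon>) + H * ((1 - p n 0 - p n 1) / t n)" for n
    proof -
      have "(1 - p n 0) / t n * m - p n 0 * ((Q n - m) / t n) - p n 1 / t n * R
          = (m - p n 0 * Q n - p n 1 * R) / t n"
        using t[of n] by (simp add: field_simps)
      moreover have "p n 1 / t n * (2 * K * \<epsilon> + 2 * H * b n \<epsilon>) + H * ((1 - p n 0 - p n 1) / t n)
          = (p n 1 * (2 * K * \<epsilon> + 2 * H * b n \<epsilon>) + H * (1 - p n 0 - p n 1)) / t n"
        by (simp add: add_divide_distrib)
      moreover have "\<bar>(m - p n 0 * Q n - p n 1 * R) / t n\<bar> = \<bar>m - p n 0 * Q n - p n 1 * R\<bar> / t n"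
        using t[of n] by simp
      ultimately show ?thesis
        using divide_right_mono[OF bound[OF \<epsilon>, of n] less_imp_le[OF t[of n]]] by (simp only:)
    qed
    then have "\<bar>rate * m - 1 * (\<sigma>\<^sup>2 / 2 * I) - rate * R\<bar> \<le> rate * (2 * K * \<epsilon> + 2 * H * 0) + H * 0"
      by (intro LIMSEQ_le[OF L U]) blast
    then show ?thesis unfolding X_def by simp
  qed
  have "\<bar>X\<bar> \<le> 0 + e" if "0 < e" for e
  proof -
    \<comment> \<open>The \<open>+ 1\<close> keeps the choice of \<epsilon> meaningful when
      \<open>K = 0\<close>.\<close>
    define d where "d = K + 1"
    have d: "0 < d" "K \<le> d" using K by (auto simp: d_def)
    have "\<bar>X\<bar> \<le> rate * (2 * K * (e / (2 * rate * d)))"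
      using that rate_pos d by (intro small) simp
    also have "\<dots> = e * (K / d)" using rate_pos d by (simp add: field_simps)
    also have "\<dots> \<le> e * 1" using that d by (intro mult_left_mono) auto
    finally show ?thesis by simp
  qed
  then have "\<bar>X\<bar> \<le> 0" by (rule field_le_epsilon)
  then show ?thesis unfolding X_def m_def R_def I_def by (simp add: algebra_simps)
qed

end

section \<open>Test functions for the exit probabilities\<close>

lemma has_real_derivative_If_le:
  fixes f g f' g' :: "real \<Rightarrow> real"
  assumes f: "\<And>x. (f has_real_derivative f' x) (at x)" and g: "\<And>x. (g has_real_derivative g' x) (at x)"
    and eq: "f c = g c" "f' c = g' c"
  shows "((\<lambda>x. if x \<le> c then f x else g x) has_real_derivative (if x \<le> c then f' x else g' x)) (at x)"
proof -
  have "((\<lambda>x. if x \<in> {..c} then f x else g x) has_vector_derivative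
      (if x \<in> {..c} then f' x else g' x)) (at x within UNIV)"
  proof (rule has_vector_derivative_If_within_closures[where S="{..c}" and T="{c<..}"])
    show "(f has_vector_derivative f' x) (at x within {..c} \<union> closure {..c} \<inter> closure {c<..})"
      using f[of x] has_real_derivative_iff_has_vector_derivative has_vector_derivative_at_within by blast
    show "(g has_vector_derivative g' x) (at x within {c<..} \<union> closure {..c} \<inter> closure {c<..})"
      using g[of x] has_real_derivative_iff_has_vector_derivative has_vector_derivative_at_within by blast
  qed (use eq in auto)
  then show ?thesis by (simp add: has_real_derivative_iff_has_vector_derivative)
qed

text \<open>For points on opposite sides one passes through \<open>c\<close>, where the branches
  agree; the two lengths add up to \<open>\<bar>x - y\<bar>\<close>.\<close>

lemma lipschitz_If_le:
  fixes f g :: "real \<Rightarrow> real"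
  assumes f: "\<And>x y. x \<le> c \<Longrightarrow> y \<le> c \<Longrightarrow> \<bar>f x - f y\<bar> \<le> K * \<bar>x - y\<bar>"
    and g: "\<And>x y. c \<le> x \<Longrightarrow> c \<le> y \<Longrightarrow> \<bar>g x - g y\<bar> \<le> K * \<bar>x - y\<bar>"
    and eq: "f c = g c"
  shows "\<bar>(if x \<le> c then f x else g x) - (if y \<le> c then f y else g y)\<bar> \<le> K * \<bar>x - y\<bar>"
proof -
  have *: "\<bar>f u - g v\<bar> \<le> K * (v - u)" if "u \<le> c" "c \<le> v" for u v
  proof -
    have "\<bar>f u - f c\<bar> \<le> K * (c - u)" "\<bar>g c - g v\<bar> \<le> K * (v - c)"
      using f[of u c] g[of c v] that by auto
    then show ?thesis using eq by (simp add: algebra_simps)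
  qed
  show ?thesis
    using f[of x y] g[of x y] *[of x y] *[of y x] by (auto simp: abs_minus_commute)
qed

lemma lipschitz_exp_nonpos:
  fixes u v :: real
  assumes "u \<le> 0" "v \<le> 0"
  shows "\<bar>exp u - exp v\<bar> \<le> \<bar>u - v\<bar>"
proof -
  have *: "exp v - exp u \<le> v - u" if "u \<le> v" "v \<le> 0" for u v :: real
  proof -
    have "exp v - exp u = exp v * (1 - exp (u - v))" by (simp add: exp_diff algebra_simps)
    also have "\<dots> \<le> 1 * (v - u)"
    proof (intro mult_mono)
      show "1 - exp (u - v) \<le> v - u" using exp_ge_add_one_self[of "u - v"] by linarith
    qed (use that in auto)
    finally show ?thesis by simp
  qed
  show ?thesis using assms *[of u v] *[of v u] by (cases "u \<le> v") (auto simp: abs_if)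
qed

text \<open>On the tails \<open>\<sigma>\<^sup>2 h'' / 2 - \<lambda> h\<close> must be constant with \<open>h\<close> bounded, which leaves only a
  constant plus a multiple of \<open>exp (- k \<bar>x\<bar>)\<close>, where \<open>k = sqrt (2 \<lambda>) / \<sigma>\<close>; continuity of \<open>h\<close>
  and \<open>h'\<close> at \<open>\<plusminus>c\<close> then fixes the coefficients.\<close>

definition test_fun :: "real \<Rightarrow> real \<Rightarrow> real \<Rightarrow> real \<Rightarrow> real \<Rightarrow> real" where
  "test_fun a b k c x =
    (if x \<le> - c then - a * c + b * c\<^sup>2 - (a - 2 * b * c) * (1 - exp (k * (x + c))) / k
     else if x \<le> c then a * x + b * x\<^sup>2
     else a * c + b * c\<^sup>2 + (a + 2 * b * c) * (1 - exp (- k * (x - c))) / k)"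

definition test_fun' :: "real \<Rightarrow> real \<Rightarrow> real \<Rightarrow> real \<Rightarrow> real \<Rightarrow> real" where
  "test_fun' a b k c x =
    (if x \<le> - c then (a - 2 * b * c) * exp (k * (x + c))
     else if x \<le> c then a + 2 * b * x
     else (a + 2 * b * c) * exp (- k * (x - c)))"

text \<open>At the kinks \<open>x = c\<close> and \<open>x = - c\<close> the value
  \<open>2 * b\<close> is a convention. It matches the reset, which leaves the barriers themselves
  fixed, so the generator formula below holds at every point.\<close>

definition test_fun'' :: "real \<Rightarrow> real \<Rightarrow> real \<Rightarrow> real \<Rightarrow> real \<Rightarrow> real" where
  "test_fun'' a b k c x =
    (if x < - c then k * (a - 2 * b * c) * exp (k * (x + c))
     else if x \<le> c then 2 * b
     else - k * (a + 2 * b * c) * exp (- k * (x - c)))"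

context
  fixes a b k c :: real
  assumes k: "0 < k" and c: "0 < c"
begin

lemma DERIV_test_fun: "(test_fun a b k c has_real_derivative test_fun' a b k c x) (at x)"
  unfolding test_fun_def[abs_def] test_fun'_def
  by (intro has_real_derivative_If_le)
     (use k c in \<open>auto intro!: derivative_eq_intros simp: field_simps\<close>)

lemma DERIV_test_fun':
  assumes "\<bar>x\<bar> \<noteq> c"
  shows "(test_fun' a b k c has_real_derivative test_fun'' a b k c x) (at x)"
proof -
  consider "x < - c" | "- c < x" "x < c" | "c < x" using assms c by linarith
  then show ?thesis
  proof cases
    case 1
    have "((\<lambda>x. (a - 2 * b * c) * exp (k * (x + c))) has_real_derivative test_fun'' a b k c x) (at x)"
      using 1 by (auto intro!: derivative_eq_intros simp: test_fun''_def)
    then show ?thesis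
      by (rule has_field_derivative_transform_within_open[where S="{..<- c}"]) (use 1 in \<open>auto simp: test_fun'_def\<close>)
  next
    case 2
    have "((\<lambda>x. a + 2 * b * x) has_real_derivative test_fun'' a b k c x) (at x)"
      using 2 by (auto intro!: derivative_eq_intros simp: test_fun''_def)
    then show ?thesis
      by (rule has_field_derivative_transform_within_open[where S="{- c<..<c}"]) (use 2 in \<open>auto simp: test_fun'_def\<close>)
  next
    case 3
    have "((\<lambda>x. (a + 2 * b * c) * exp (- k * (x - c))) has_real_derivative test_fun'' a b k c x) (at x)"
      using 3 c by (auto intro!: derivative_eq_intros simp: test_fun''_def)
    then show ?thesis
      by (rule has_field_derivative_transform_within_open[where S="{c<..}"]) (use 3 c in \<open>auto simp: test_fun'_def\<close>)
  qed
qed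

text \<open>The derivative is affine between the barriers and decays exponentially from its barrier
  values outside.\<close>

lemma test_fun'_bound: "\<bar>test_fun' a b k c x\<bar> \<le> \<bar>a\<bar> + 2 * \<bar>b\<bar> * c"
proof -
  have A: "\<bar>a + 2 * b * y\<bar> \<le> \<bar>a\<bar> + 2 * \<bar>b\<bar> * c" if "\<bar>y\<bar> \<le> c" for y
  proof -
    have "\<bar>a + 2 * b * y\<bar> \<le> \<bar>a\<bar> + 2 * (\<bar>b\<bar> * \<bar>y\<bar>)"
      using abs_triangle_ineq[of a "2 * b * y"] by (simp add: abs_mult)
    moreover have "\<bar>b\<bar> * \<bar>y\<bar> \<le> \<bar>b\<bar> * c" using that by (intro mult_left_mono) auto
    ultimately show ?thesis by simp
  qed
  have B: "\<bar>d\<bar> * exp y \<le> \<bar>a\<bar> + 2 * \<bar>b\<bar> * c" if "\<bar>d\<bar> \<le> \<bar>a\<bar> + 2 * \<bar>b\<bar> * c" "y \<le> 0" for d y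
  proof -
    have "\<bar>d\<bar> * exp y \<le> \<bar>d\<bar> * 1" using that(2) by (intro mult_left_mono) auto
    then show ?thesis using that(1) by simp
  qed
  have le1: "k * (x + c) \<le> 0" if "x \<le> - c" using k that by (simp add: mult_le_0_iff)
  have le2: "- (k * (x - c)) \<le> 0" if "c < x" using k that by simp
  have d: "\<bar>a - 2 * b * c\<bar> \<le> \<bar>a\<bar> + 2 * \<bar>b\<bar> * c" "\<bar>a + 2 * b * c\<bar> \<le> \<bar>a\<bar> + 2 * \<bar>b\<bar> * c"
    using A[of "- c"] A[of c] c by simp_all
  consider "x \<le> - c" | "\<not> x \<le> - c" "x \<le> c" "\<bar>x\<bar> \<le> c" | "c < x" by linarith
  then show ?thesis
  proof cases
    case 1
    then show ?thesis using B[OF d(1) le1] by (simp add: test_fun'_def abs_mult)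
  next
    case 2
    then show ?thesis using A[of x] by (simp add: test_fun'_def)
  next
    case 3
    then show ?thesis using B[OF d(2) le2] c by (simp add: test_fun'_def abs_mult)
  qed
qed

lemma test_fun_lipschitz:
  "\<bar>test_fun a b k c x - test_fun a b k c y\<bar> \<le> (\<bar>a\<bar> + 2 * \<bar>b\<bar> * c) * \<bar>x - y\<bar>"
proof -
  have "norm (test_fun a b k c x - test_fun a b k c y) \<le> (\<bar>a\<bar> + 2 * \<bar>b\<bar> * c) * norm (x - y)"
    by (rule field_differentiable_bound[where S=UNIV and f'="test_fun' a b k c"])
       (use DERIV_test_fun test_fun'_bound in auto)
  then show ?thesis by simp
qed

text \<open>The function vanishes at 0, so up to the barriers the Lipschitz bound gives the first
  summand; each exponential tail adds at most its full saturation, the second.\<close>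

lemma test_fun_bound:
  "\<bar>test_fun a b k c x\<bar> \<le> (\<bar>a\<bar> + 2 * \<bar>b\<bar> * c) * c + (\<bar>a\<bar> + 2 * \<bar>b\<bar> * c) / k"
proof -
  define A where "A = \<bar>a\<bar> + 2 * \<bar>b\<bar> * c"
  have A0: "0 \<le> A" using c by (simp add: A_def)
  have inner: "\<bar>test_fun a b k c y\<bar> \<le> A * c" if "\<bar>y\<bar> \<le> c" for y
  proof -
    have "\<bar>test_fun a b k c y\<bar> \<le> A * \<bar>y\<bar>"
      using test_fun_lipschitz[of y 0] c by (simp add: A_def test_fun_def)
    also have "\<dots> \<le> A * c" using that A0 by (rule mult_left_mono)
    finally show ?thesis .
  qed
  have tail: "\<bar>d * (1 - exp y) / k\<bar> \<le> A / k" if "\<bar>d\<bar> \<le> A" "y \<le> 0" for d y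
  proof -
    have "\<bar>d\<bar> * \<bar>1 - exp y\<bar> \<le> A * 1" using that A0 by (intro mult_mono) auto
    then show ?thesis using k by (simp add: abs_mult divide_right_mono)
  qed
  have d: "\<bar>a - 2 * b * c\<bar> \<le> A" "\<bar>a + 2 * b * c\<bar> \<le> A"
    using test_fun'_bound[of "- c"] test_fun'_bound[of c] c by (auto simp: A_def test_fun'_def)
  have m: "test_fun a b k c (- c) = - a * c + b * c\<^sup>2" "test_fun a b k c c = a * c + b * c\<^sup>2"
    using c by (auto simp: test_fun_def)
  have ends: "\<bar>test_fun a b k c (- c)\<bar> \<le> A * c" "\<bar>test_fun a b k c c\<bar> \<le> A * c"
    using inner[of "- c"] inner[of c] c by simp_all
  consider "x \<le> - c" | "\<bar>x\<bar> \<le> c" | "c < x" by linarith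
  then show ?thesis
  proof cases
    case 1
    then have "test_fun a b k c x = test_fun a b k c (- c) - (a - 2 * b * c) * (1 - exp (k * (x + c))) / k"
      unfolding m by (simp add: test_fun_def)
    moreover have "k * (x + c) \<le> 0" using k 1 by (simp add: mult_le_0_iff)
    ultimately show ?thesis
      using tail[OF d(1), of "k * (x + c)"] ends unfolding A_def[symmetric] by linarith
  next
    case 2
    moreover have "0 \<le> A / k" using A0 k by simp
    ultimately show ?thesis using inner[of x] unfolding A_def[symmetric] by simp
  next
    case 3
    then have "test_fun a b k c x = test_fun a b k c c + (a + 2 * b * c) * (1 - exp (- k * (x - c))) / k"
      unfolding m using c by (simp add: test_fun_def)
    moreover have "- k * (x - c) \<le> 0" using k 3 by simp
    ultimately show ?thesis
      using tail[OF d(2), of "- k * (x - c)"] ends unfolding A_def[symmetric] by linarith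
  qed
qed

text \<open>The slope is at most \<open>k\<close> times the derivative bound on the tails and
  \<open>2 * \<bar>b\<bar>\<close> between them; continuity at the barriers glues the pieces in
  spite of the kinks.\<close>

lemma test_fun'_lipschitz:
  "\<bar>test_fun' a b k c x - test_fun' a b k c y\<bar> \<le> (k * (\<bar>a\<bar> + 2 * \<bar>b\<bar> * c) + 2 * \<bar>b\<bar>) * \<bar>x - y\<bar>"
proof -
  define A where "A = \<bar>a\<bar> + 2 * \<bar>b\<bar> * c"
  have kA: "0 \<le> k * A" using k c by (simp add: A_def)
  have d: "\<bar>a - 2 * b * c\<bar> \<le> A" "\<bar>a + 2 * b * c\<bar> \<le> A"
    using test_fun'_bound[of "- c"] test_fun'_bound[of c] c by (auto simp: A_def test_fun'_def)
  have tail: "\<bar>d * exp u - d * exp v\<bar> \<le> (k * A + 2 * \<bar>b\<bar>) * \<bar>x - y\<bar>"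
    if "\<bar>d\<bar> \<le> A" "u \<le> 0" "v \<le> 0" "\<bar>u - v\<bar> = k * \<bar>x - y\<bar>" for d u v x y
  proof -
    have "\<bar>d * exp u - d * exp v\<bar> = \<bar>d\<bar> * \<bar>exp u - exp v\<bar>"
      by (simp add: abs_mult[symmetric] algebra_simps)
    also have "\<dots> \<le> A * \<bar>u - v\<bar>"
      using that lipschitz_exp_nonpos[of u v] by (intro mult_mono) auto
    also have "\<dots> = k * A * \<bar>x - y\<bar>" using that(4) by simp
    also have "\<dots> \<le> (k * A + 2 * \<bar>b\<bar>) * \<bar>x - y\<bar>" by (intro mult_right_mono) auto
    finally show ?thesis .
  qed
  have middle: "\<bar>(a + 2 * b * x) - (a + 2 * b * y)\<bar> \<le> (k * A + 2 * \<bar>b\<bar>) * \<bar>x - y\<bar>" for x y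
  proof -
    have "(a + 2 * b * x) - (a + 2 * b * y) = 2 * b * (x - y)" by (simp add: algebra_simps)
    then have "\<bar>(a + 2 * b * x) - (a + 2 * b * y)\<bar> = 2 * \<bar>b\<bar> * \<bar>x - y\<bar>" by (simp add: abs_mult)
    also have "\<dots> \<le> (k * A + 2 * \<bar>b\<bar>) * \<bar>x - y\<bar>" using kA by (intro mult_right_mono) auto
    finally show ?thesis .
  qed
  have scale: "\<bar>k * u - k * v\<bar> = k * \<bar>u - v\<bar>" for u v
    using k by (simp add: abs_mult flip: right_diff_distrib)
  have right: "\<bar>(if x \<le> c then a + 2 * b * x else (a + 2 * b * c) * exp (- k * (x - c)))
      - (if y \<le> c then a + 2 * b * y else (a + 2 * b * c) * exp (- k * (y - c)))\<bar>
      \<le> (k * A + 2 * \<bar>b\<bar>) * \<bar>x - y\<bar>" for x y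
  proof (rule lipschitz_If_le)
    fix x y assume "c \<le> x" "c \<le> y"
    then show "\<bar>(a + 2 * b * c) * exp (- k * (x - c)) - (a + 2 * b * c) * exp (- k * (y - c))\<bar>
        \<le> (k * A + 2 * \<bar>b\<bar>) * \<bar>x - y\<bar>"
      using k scale[of "y - c" "x - c"] by (intro tail d) (auto simp: abs_minus_commute)
  qed (use middle in auto)
  show ?thesis
    unfolding test_fun'_def A_def[symmetric]
  proof (rule lipschitz_If_le)
    fix x y assume "x \<le> - c" "y \<le> - c"
    then show "\<bar>(a - 2 * b * c) * exp (k * (x + c)) - (a - 2 * b * c) * exp (k * (y + c))\<bar>
        \<le> (k * A + 2 * \<bar>b\<bar>) * \<bar>x - y\<bar>"
      using k scale[of "x + c" "y + c"] by (intro tail d) (auto simp: mult_le_0_iff)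
  qed (use right c in auto)
qed

end

lemma borel_measurable_test_fun''[measurable]: "test_fun'' a b k c \<in> borel_measurable borel"
  unfolding test_fun''_def[abs_def] by measurable

text \<open>The choice of \<open>k\<close> cancels the exponentials of
  \<open>\<sigma>\<^sup>2 * h'' / 2\<close> against those of \<open>r * h\<close>. What survives on
  a tail is \<open>r\<close> times the difference between \<open>h\<close> at the reset point and
  the limit of \<open>h\<close> at infinity on that side.\<close>

lemma test_fun_generator:
  assumes pos: "0 < \<gamma>" "0 < \<delta>" "0 < k" and k: "\<sigma>\<^sup>2 * k\<^sup>2 = 2 * r"
  defines "c \<equiv> \<gamma> + \<delta>"
  shows "\<sigma>\<^sup>2 / 2 * test_fun'' a b k c x + r * (test_fun a b k c (arb_reset \<gamma> \<delta> x) - test_fun a b k c x)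
    = \<sigma>\<^sup>2 * b * indicator {- c..c} x
      + r * (a * (\<gamma> - c) + b * (\<gamma>\<^sup>2 - c\<^sup>2) - (a + 2 * b * c) / k) * indicator {c<..} x
      + r * (a * (c - \<gamma>) + b * (\<gamma>\<^sup>2 - c\<^sup>2) + (a - 2 * b * c) / k) * indicator {..<- c} x"
proof -
  have c: "\<gamma> < c" "0 < c" using pos by (auto simp: c_def)
  have m: "test_fun a b k c \<gamma> = a * \<gamma> + b * \<gamma>\<^sup>2" "test_fun a b k c (- \<gamma>) = - a * \<gamma> + b * \<gamma>\<^sup>2"
    using c pos by (auto simp: test_fun_def)
  \<comment> \<open>This is where the exponentials cancel:
    \<open>\<sigma>\<^sup>2 * k / 2 = r / k\<close>.\<close>
  have r: "\<sigma>\<^sup>2 / 2 * (k * y) = r * (y / k)" for y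
    using k pos(3) by (simp add: field_simps power2_eq_square)
  consider "x < - c" | "- c \<le> x" "x \<le> c" | "c < x" by linarith
  then show ?thesis
  proof cases
    case 1
    then have "arb_reset \<gamma> \<delta> x = - \<gamma>" using c by (auto simp: arb_reset_def c_def)
    moreover have "test_fun'' a b k c x = k * ((a - 2 * b * c) * exp (k * (x + c)))"
      using 1 by (simp add: test_fun''_def)
    ultimately show ?thesis
      using 1 c r m by (simp add: test_fun_def) (simp add: algebra_simps diff_divide_distrib add_divide_distrib)
  next
    case 2
    then have "arb_reset \<gamma> \<delta> x = x" by (auto simp: arb_reset_def c_def)
    then show ?thesis using 2 by (simp add: test_fun''_def)
  next
    case 3
    then have "arb_reset \<gamma> \<delta> x = \<gamma>" using c by (auto simp: arb_reset_def c_def)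
    moreover have "test_fun'' a b k c x = k * (- (a + 2 * b * c) * exp (- k * (x - c)))"
      using 3 c by (simp add: test_fun''_def algebra_simps)
    ultimately show ?thesis
      using 3 c r m by (simp add: test_fun_def) (simp add: algebra_simps diff_divide_distrib add_divide_distrib)
  qed
qed

section \<open>The exit probabilities\<close>

context mispricing_process begin

text \<open>The integrand of the generator identity is now a step function, so the identity becomes
  a linear equation in three probabilities, with \<open>a\<close> and \<open>b\<close> free.\<close>

lemma stationary_exit_identity:
  assumes pos: "0 < \<sigma>" "0 < \<gamma>" "0 < \<delta>"
    and stat: "\<And>t. 0 \<le> t \<Longrightarrow> distr M borel (z t) = \<pi>"
  defines "c \<equiv> \<gamma> + \<delta>" and "k \<equiv> sqrt (2 * rate) / \<sigma>"
  shows "\<sigma>\<^sup>2 * b * measure \<pi> {- c..c}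
    + rate * (a * (\<gamma> - c) + b * (\<gamma>\<^sup>2 - c\<^sup>2) - (a + 2 * b * c) / k) * measure \<pi> {c<..}
    + rate * (a * (c - \<gamma>) + b * (\<gamma>\<^sup>2 - c\<^sup>2) + (a - 2 * b * c) / k) * measure \<pi> {..<- c} = 0"
    (is "?A * _ + ?B * _ + ?C * _ = 0")
proof -
  have \<pi>: "\<pi> = distr M borel (z 0)" using stat[of 0] by simp
  have sets[measurable_cong]: "sets \<pi> = sets borel" by (simp add: \<pi>)
  interpret P: prob_space \<pi> unfolding \<pi> by (rule prob_space_distr) (simp add: z_measurable)
  have k0: "0 < k" using pos rate_pos by (simp add: k_def)
  have c0: "0 < c" using pos by (simp add: c_def)
  have k2: "\<sigma>\<^sup>2 * k\<^sup>2 = 2 * rate" using pos rate_pos by (simp add: k_def power_divide)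
  let ?h = "test_fun a b k c" and ?h'' = "test_fun'' a b k c"
  note bounds = test_fun_bound[OF k0 c0, of a b]
  have [measurable]: "?h \<in> borel_measurable borel"
    using DERIV_test_fun[OF k0 c0]
    by (intro borel_measurable_continuous_onI) (meson DERIV_isCont continuous_at_imp_continuous_on)
  have i1: "integrable \<pi> ?h" "integrable \<pi> (\<lambda>x. ?h (arb_reset \<gamma> \<delta> x))"
    by (intro P.integrable_const_bound[where B="(\<bar>a\<bar> + 2 * \<bar>b\<bar> * c) * c + (\<bar>a\<bar> + 2 * \<bar>b\<bar> * c) / k"] AE_I2;
        use bounds in simp)+
  have gen: "\<sigma>\<^sup>2 / 2 * ?h'' x + rate * (?h (arb_reset \<gamma> \<delta> x) - ?h x)
      = ?A * indicator {- c..c} x + ?B * indicator {c<..} x + ?C * indicator {..<- c} x" for x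
    using test_fun_generator[OF pos(2,3) k0 k2] unfolding c_def by blast
  \<comment> \<open>Solving the generator formula for the second derivative expresses it by
    functions already known to be integrable.\<close>
  have h'': "?h'' x = 2 / \<sigma>\<^sup>2 * (?A * indicator {- c..c} x + ?B * indicator {c<..} x + ?C * indicator {..<- c} x
      - rate * (?h (arb_reset \<gamma> \<delta> x) - ?h x))" for x
    unfolding gen[symmetric] using pos by simp
  have i2: "integrable \<pi> ?h''"
    unfolding h''[abs_def] using i1
    by (intro integrable_mult_right Bochner_Integration.integrable_diff Bochner_Integration.integrable_add)
       (auto simp: P.emeasure_eq_measure)
  have "0 = \<sigma>\<^sup>2 / 2 * (\<integral>x. ?h'' x \<partial>\<pi>) + rate * ((\<integral>x. ?h (arb_reset \<gamma> \<delta> x) \<partial>\<pi>) - (\<integral>x. ?h x \<partial>\<pi>))"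
    by (rule stationary_generator_identity[OF pos stat, symmetric])
       (use DERIV_test_fun[OF k0 c0] DERIV_test_fun'[OF k0 c0] bounds test_fun_lipschitz[OF k0 c0]
            test_fun'_lipschitz[OF k0 c0] in \<open>auto simp: c_def\<close>)
  also have "\<dots> = (\<integral>x. \<sigma>\<^sup>2 / 2 * ?h'' x + rate * (?h (arb_reset \<gamma> \<delta> x) - ?h x) \<partial>\<pi>)"
    using i1 i2 by simp
  also have "\<dots> = ?A * measure \<pi> {- c..c} + ?B * measure \<pi> {c<..} + ?C * measure \<pi> {..<- c}"
    unfolding gen by (simp add: P.emeasure_eq_measure sets)
  finally show ?thesis by simp
qed

theorem stationary_exit_probabilities:
  assumes pos: "0 < \<sigma>" "0 < \<gamma>" "0 < \<delta>"
    and stat: "\<And>t. 0 \<le> t \<Longrightarrow> distr M borel (z t) = \<pi>"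
  defines "\<eta> \<equiv> sqrt (2 * rate) * (\<gamma> + \<delta>) / \<sigma>"
  shows "measure \<pi> {\<gamma> + \<delta><..} = 1 / (2 + 2 * \<eta> + \<eta>\<^sup>2 * (1 - (\<gamma> / (\<gamma> + \<delta>))\<^sup>2))"
    and "measure \<pi> {..<- (\<gamma> + \<delta>)} = 1 / (2 + 2 * \<eta> + \<eta>\<^sup>2 * (1 - (\<gamma> / (\<gamma> + \<delta>))\<^sup>2))"
proof -
  define c where "c = \<gamma> + \<delta>"
  define k where "k = sqrt (2 * rate) / \<sigma>"
  have \<pi>: "\<pi> = distr M borel (z 0)" using stat[of 0] by simp
  have sets[measurable_cong]: "sets \<pi> = sets borel" by (simp add: \<pi>)
  interpret P: prob_space \<pi> unfolding \<pi> by (rule prob_space_distr) (simp add: z_measurable)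
  have k0: "0 < k" using pos rate_pos by (simp add: k_def)
  have c0: "0 < c" "\<gamma> < c" using pos by (auto simp: c_def)
  have k2: "\<sigma>\<^sup>2 * k\<^sup>2 = 2 * rate" using pos rate_pos by (simp add: k_def power_divide)
  define p where "p = measure \<pi> {c<..}"
  define q where "q = measure \<pi> {..<- c}"
  note id = stationary_exit_identity[OF pos stat, folded c_def k_def, folded p_def q_def]
  have "P.prob ({- c..c} \<union> ({c<..} \<union> {..<- c})) = P.prob {- c..c} + P.prob ({c<..} \<union> {..<- c})"
    using c0 by (intro P.finite_measure_Union) (auto simp: sets)
  also have "P.prob ({c<..} \<union> {..<- c}) = p + q"
    unfolding p_def q_def using c0 by (intro P.finite_measure_Union) (auto simp: sets)
  also have "{- c..c} \<union> ({c<..} \<union> {..<- c}) = space \<pi>" by (auto simp: \<pi>)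
  finally have mid: "measure \<pi> {- c..c} = 1 - p - q" by (simp add: P.prob_space)
  \<comment> \<open>The linear test function, \<open>b = 0\<close> and \<open>a = 1\<close>: odd, so
    it compares the two tails.\<close>
  have "rate * (\<gamma> - c - 1 / k) * (p - q) = 0"
    using id[of 0 1] by (simp add: algebra_simps diff_divide_distrib)
  moreover have "0 < 1 / k" using k0 by simp
  then have "\<gamma> - c - 1 / k < 0" using c0(2) by linarith
  ultimately have pq: "q = p" using rate_pos by simp
  \<comment> \<open>The quadratic test function, \<open>b = 1\<close> and \<open>a = 0\<close>; with
    equal tails and total mass one only \<open>p\<close> is left.\<close>
  have "\<sigma>\<^sup>2 * (1 - 2 * p) + 2 * rate * (\<gamma>\<^sup>2 - c\<^sup>2 - 2 * c / k) * p = 0"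
    using id[of 1 0] unfolding mid pq by (simp add: algebra_simps)
  then have "\<sigma>\<^sup>2 * (1 - 2 * p + k\<^sup>2 * (\<gamma>\<^sup>2 - c\<^sup>2 - 2 * c / k) * p) = 0"
    unfolding k2[symmetric] by (simp add: algebra_simps)
  then have "1 - 2 * p + k\<^sup>2 * (\<gamma>\<^sup>2 - c\<^sup>2 - 2 * c / k) * p = 0" using pos by simp
  moreover have "k\<^sup>2 * (\<gamma>\<^sup>2 - c\<^sup>2 - 2 * c / k) = k\<^sup>2 * (\<gamma>\<^sup>2 - c\<^sup>2) - 2 * (k * c)"
    using k0 by (simp add: field_simps power2_eq_square)
  ultimately have "p * (2 + 2 * (k * c) + k\<^sup>2 * (c\<^sup>2 - \<gamma>\<^sup>2)) = 1"
    by (simp add: algebra_simps)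
  moreover have \<eta>: "k * c = \<eta>" by (simp add: \<eta>_def k_def c_def)
  moreover have "k\<^sup>2 * (c\<^sup>2 - \<gamma>\<^sup>2) = \<eta>\<^sup>2 * (1 - (\<gamma> / c)\<^sup>2)"
  proof -
    have "c\<^sup>2 * (1 - (\<gamma> / c)\<^sup>2) = c\<^sup>2 - \<gamma>\<^sup>2"
      using c0 by (simp add: power_divide right_diff_distrib)
    then show ?thesis by (simp add: \<eta>[symmetric] power_mult_distrib mult.assoc)
  qed
  ultimately have "p * (2 + 2 * \<eta> + \<eta>\<^sup>2 * (1 - (\<gamma> / c)\<^sup>2)) = 1" by simp
  \<comment> \<open>The denominator cannot be 0, since its product with \<open>p\<close> is
    1.\<close>
  then have p: "p = 1 / (2 + 2 * \<eta> + \<eta>\<^sup>2 * (1 - (\<gamma> / c)\<^sup>2))"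
    by (metis mult_zero_right nonzero_eq_divide_eq zero_neq_one)
  show "measure \<pi> {\<gamma> + \<delta><..} = 1 / (2 + 2 * \<eta> + \<eta>\<^sup>2 * (1 - (\<gamma> / (\<gamma> + \<delta>))\<^sup>2))"
    using p unfolding p_def c_def .
  show "measure \<pi> {..<- (\<gamma> + \<delta>)} = 1 / (2 + 2 * \<eta> + \<eta>\<^sup>2 * (1 - (\<gamma> / (\<gamma> + \<delta>))\<^sup>2))"
    using p pq unfolding q_def c_def by simp
qed

end

section \<open>Small gas fees\<close>

lemma pool_value_optimal:
  assumes "optimal_reserves f L Q (x, y)"
  shows "pool_value f L Q = Q * x + y"
    and "(u, v) \<in> pool_reserves f L \<Longrightarrow> Q * x + y \<le> Q * u + v"
proof -
  have mem: "(x, y) \<in> pool_reserves f L"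
    and le: "\<And>u v. (u, v) \<in> pool_reserves f L \<Longrightarrow> Q * x + y \<le> Q * u + v"
    using assms by (auto simp: optimal_reserves_def is_arg_min_linorder)
  show "pool_value f L Q = Q * x + y"
    unfolding pool_value_def using mem le by (intro cInf_eq_minimum) (auto intro: rev_image_eqI)
  show "(u, v) \<in> pool_reserves f L \<Longrightarrow> Q * x + y \<le> Q * u + v" by (rule le)
qed

text \<open>The reserves optimal at \<open>Q\<close> stay feasible at every other price, so their
  value is a line that lies above the pool value and touches it at \<open>Q\<close>. The gap has a
  local minimum there and its derivative vanishes.\<close>

lemma pool_value_envelope:
  assumes optimal: "\<And>Q. 0 \<le> Q \<Longrightarrow> optimal_reserves f L Q (xs Q, ys Q)"
    and Q: "0 < Q" and V: "(pool_value f L has_real_derivative D) (at Q)"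
  shows "xs Q = D"
proof -
  have "((\<lambda>R. R * xs Q + ys Q - pool_value f L R) has_real_derivative xs Q - D) (at Q)"
    using V by (auto intro!: derivative_eq_intros)
  moreover have "Q * xs Q + ys Q - pool_value f L Q \<le> R * xs Q + ys Q - pool_value f L R"
    if "\<bar>Q - R\<bar> < Q" for R
  proof -
    have R: "0 \<le> R" using that by simp
    have "(xs Q, ys Q) \<in> pool_reserves f L"
      using optimal[of Q] Q by (simp add: optimal_reserves_def is_arg_min_def)
    then have "R * xs R + ys R \<le> R * xs Q + ys Q"
      by (rule pool_value_optimal(2)[OF optimal[OF R]])
    then show ?thesis
      using pool_value_optimal(1)[OF optimal[OF R]] pool_value_optimal(1)[OF optimal[of Q]] Q by simp
  qed
  ultimately have "xs Q - D = 0" using DERIV_local_min[OF _ Q] by blast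
  then show ?thesis by simp
qed

text \<open>The tangent is taken at the moved point \<open>Q + u\<close>. Moving it back to
  \<open>Q\<close> costs \<open>(V' (Q + u) - V' Q) / u\<close>, which turns the Taylor limit
  \<open>D / 2\<close> into \<open>D / 2 - D\<close>.\<close>

lemma bregman_second_order:
  fixes V V' :: "real \<Rightarrow> real"
  assumes S: "open S" "Q \<in> S" and V: "\<And>R. R \<in> S \<Longrightarrow> (V has_real_derivative V' R) (at R)"
    and V': "(V' has_real_derivative D) (at Q)"
  shows "((\<lambda>u. (V (Q + u) - V Q - V' (Q + u) * u) / u\<^sup>2) \<longlongrightarrow> - D / 2) (at 0)"
proof -
  have "((\<lambda>u. (V (Q + u) - V Q - V' Q * u) / u\<^sup>2 - (V' (Q + u) - V' Q) / u) \<longlongrightarrow> D / 2 - D) (at 0)"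
    using V' by (intro tendsto_diff second_order_difference_quotient[OF S V V']) (simp_all add: DERIV_def)
  moreover have "eventually (\<lambda>u. (V (Q + u) - V Q - V' Q * u) / u\<^sup>2 - (V' (Q + u) - V' Q) / u
      = (V (Q + u) - V Q - V' (Q + u) * u) / u\<^sup>2) (at 0)"
    by (auto simp: eventually_at_filter field_simps power2_eq_square)
  ultimately show ?thesis by (auto elim: Lim_transform_eventually)
qed

text \<open>Inserting \<open>xs = V'\<close> and \<open>ys R = V R - R * V' R\<close>, with
  \<open>V\<close> the pool value, collapses the loss to the Bregman remainder of \<open>V\<close>
  at the displacement \<open>u\<close>. The sign \<open>s\<close> is the direction of the price
  move; it disappears because \<open>u\<close> is squared.\<close>

lemma rebalancing_loss_second_order:
  assumes optimal: "\<And>Q. 0 \<le> Q \<Longrightarrow> optimal_reserves f L Q (xs Q, ys Q)"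
    and V: "\<And>Q. 0 < Q \<Longrightarrow> (pool_value f L has_real_derivative V' Q) (at Q)"
    and V': "\<And>Q. 0 < Q \<Longrightarrow> (V' has_real_derivative V'' Q) (at Q)"
    and Q: "0 < Q" and s: "s = 1 \<or> s = - 1"
  shows "((\<lambda>\<delta>. (Q * (xs (Q * exp (s * \<delta>)) - xs Q) + (ys (Q * exp (s * \<delta>)) - ys Q)) / \<delta>\<^sup>2)
    \<longlongrightarrow> Q * deriv ys Q / 2) (at_right 0)"
proof -
  let ?V = "pool_value f L"
  have xs: "xs R = V' R" if "0 < R" for R
    using pool_value_envelope[OF optimal that V[OF that]] .
  have ys: "ys R = ?V R - R * V' R" if "0 < R" for R
    using pool_value_optimal(1)[OF optimal[of R]] xs[OF that] that by simp
  have "((\<lambda>R. ?V R - R * V' R) has_real_derivative - Q * V'' Q) (at Q)"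
    using V[OF Q] V'[OF Q] by (auto intro!: derivative_eq_intros)
  then have "(ys has_real_derivative - Q * V'' Q) (at Q)"
    by (rule has_field_derivative_transform_within_open[where S="{0<..}"]) (use Q ys in auto)
  then have dys: "deriv ys Q = - Q * V'' Q" by (rule DERIV_imp_deriv)
  \<comment> \<open>The additive displacement of the price; it behaves like
    \<open>s * Q * \<delta>\<close>, whence the factor \<open>Q\<^sup>2\<close> in the
    limit.\<close>
  define u where "u \<delta> = Q * (exp (s * \<delta>) - 1)" for \<delta>
  have u_lim: "(u \<longlongrightarrow> 0) (at_right 0)"
    using s Q unfolding u_def by (elim disjE; hypsubst; real_asymp)
  have u2: "((\<lambda>\<delta>. (u \<delta>)\<^sup>2 / \<delta>\<^sup>2) \<longlongrightarrow> Q\<^sup>2) (at_right 0)"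
    using s Q unfolding u_def by (elim disjE; hypsubst; real_asymp simp: power2_eq_square)
  have u0: "u \<delta> \<noteq> 0" if "0 < \<delta>" for \<delta> using that Q s by (auto simp: u_def)
  have "filterlim u (at 0) (at_right 0)"
    using u_lim u0 by (intro filterlim_atI) (auto simp: eventually_at_filter)
  moreover have "((\<lambda>u. (?V (Q + u) - ?V Q - V' (Q + u) * u) / u\<^sup>2) \<longlongrightarrow> - V'' Q / 2) (at 0)"
    using Q V V' by (intro bregman_second_order[where S="{0<..}"]) auto
  ultimately have "((\<lambda>\<delta>. (?V (Q + u \<delta>) - ?V Q - V' (Q + u \<delta>) * u \<delta>) / (u \<delta>)\<^sup>2) \<longlongrightarrow> - V'' Q / 2) (at_right 0)"
    by (rule filterlim_compose[rotated])
  from tendsto_mult[OF this u2]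
  have "((\<lambda>\<delta>. (?V (Q + u \<delta>) - ?V Q - V' (Q + u \<delta>) * u \<delta>) / (u \<delta>)\<^sup>2 * ((u \<delta>)\<^sup>2 / \<delta>\<^sup>2))
      \<longlongrightarrow> - V'' Q / 2 * Q\<^sup>2) (at_right 0)" .
  moreover have "eventually (\<lambda>\<delta>. (?V (Q + u \<delta>) - ?V Q - V' (Q + u \<delta>) * u \<delta>) / (u \<delta>)\<^sup>2 * ((u \<delta>)\<^sup>2 / \<delta>\<^sup>2)
      = (Q * (xs (Q * exp (s * \<delta>)) - xs Q) + (ys (Q * exp (s * \<delta>)) - ys Q)) / \<delta>\<^sup>2) (at_right 0)"
    using eventually_at_right_less[of 0]
  proof eventually_elim
    case (elim \<delta>)
    have Qu: "Q * exp (s * \<delta>) = Q + u \<delta>" by (simp add: u_def algebra_simps)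
    have pos: "0 < Q + u \<delta>" using Q unfolding Qu[symmetric] by simp
    have cancel: "A / (u \<delta>)\<^sup>2 * ((u \<delta>)\<^sup>2 / \<delta>\<^sup>2) = A / \<delta>\<^sup>2" for A using u0[OF elim] by simp
    show ?case unfolding Qu xs[OF pos] xs[OF Q] ys[OF pos] ys[OF Q] cancel
      by (simp add: algebra_simps)
  qed
  ultimately have "((\<lambda>\<delta>. (Q * (xs (Q * exp (s * \<delta>)) - xs Q) + (ys (Q * exp (s * \<delta>)) - ys Q)) / \<delta>\<^sup>2)
      \<longlongrightarrow> - V'' Q / 2 * Q\<^sup>2) (at_right 0)"
    by (rule Lim_transform_eventually)
  then show ?thesis by (simp add: dys power2_eq_square algebra_simps)
qed

text \<open>After division by \<open>rate\<close> only the quadratic term of the denominator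
  survives; its coefficient is positive because \<open>\<gamma> < c\<close>.\<close>

lemma fast_block_exit_rate:
  fixes \<sigma> \<gamma> c :: real
  assumes "0 < \<sigma>" "0 < \<gamma>" "\<gamma> < c"
  shows "((\<lambda>rate. rate * (1 / (2 + 2 * (sqrt (2 * rate) * c / \<sigma>)
      + (sqrt (2 * rate) * c / \<sigma>)\<^sup>2 * (1 - (\<gamma> / c)\<^sup>2)))) \<longlongrightarrow> \<sigma>\<^sup>2 / (2 * (c\<^sup>2 - \<gamma>\<^sup>2))) at_top"
proof -
  have D: "0 < 1 - (\<gamma> / c)\<^sup>2" using assms by (simp add: power_less_one_iff abs_square_less_1)
  have lim: "((\<lambda>rate. 1 / (2 / rate + 2 * (sqrt 2 * c / \<sigma>) / sqrt rate
      + 2 * c\<^sup>2 / \<sigma>\<^sup>2 * (1 - (\<gamma> / c)\<^sup>2))) \<longlongrightarrow> 1 / (0 + 0 + 2 * c\<^sup>2 / \<sigma>\<^sup>2 * (1 - (\<gamma> / c)\<^sup>2))) at_top"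
    using D assms
    by (intro tendsto_intros real_tendsto_divide_at_top[OF tendsto_const] sqrt_at_top filterlim_ident) auto
  have "2 * c\<^sup>2 / \<sigma>\<^sup>2 * (1 - (\<gamma> / c)\<^sup>2) = 2 * (c\<^sup>2 - \<gamma>\<^sup>2) / \<sigma>\<^sup>2"
    using assms by (simp add: field_simps)
  then have limit: "1 / (0 + 0 + 2 * c\<^sup>2 / \<sigma>\<^sup>2 * (1 - (\<gamma> / c)\<^sup>2)) = \<sigma>\<^sup>2 / (2 * (c\<^sup>2 - \<gamma>\<^sup>2))"
    by simp
  have "eventually (\<lambda>rate. 1 / (2 / rate + 2 * (sqrt 2 * c / \<sigma>) / sqrt rate
        + 2 * c\<^sup>2 / \<sigma>\<^sup>2 * (1 - (\<gamma> / c)\<^sup>2))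
      = rate * (1 / (2 + 2 * (sqrt (2 * rate) * c / \<sigma>)
        + (sqrt (2 * rate) * c / \<sigma>)\<^sup>2 * (1 - (\<gamma> / c)\<^sup>2)))) at_top"
    using eventually_gt_at_top[of 0]
  proof eventually_elim
    case (elim r)
    define d where "d = 1 - (\<gamma> / c)\<^sup>2"
    have e: "2 + 2 * (sqrt (2 * r) * c / \<sigma>) + (sqrt (2 * r) * c / \<sigma>)\<^sup>2 * d
        = r * (2 / r + 2 * (sqrt 2 * c / \<sigma>) / sqrt r + 2 * c\<^sup>2 / \<sigma>\<^sup>2 * d)"
    proof -
      have "r * (2 * (sqrt 2 * c / \<sigma>) / sqrt r) = 2 * (sqrt (2 * r) * c / \<sigma>)"
      proof -
        have "r * (2 * (sqrt 2 * c / \<sigma>) / sqrt r) = 2 * (sqrt 2 * c / \<sigma>) * (r / sqrt r)" by simp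
        also have "\<dots> = 2 * (sqrt (2 * r) * c / \<sigma>)" using elim by (simp add: real_div_sqrt real_sqrt_mult)
        finally show ?thesis .
      qed
      moreover have "r * (2 * c\<^sup>2 / \<sigma>\<^sup>2 * d) = (sqrt (2 * r) * c / \<sigma>)\<^sup>2 * d"
        using elim by (simp add: power_mult_distrib power_divide)
      ultimately show ?thesis using elim by (simp add: distrib_left)
    qed
    show ?case unfolding d_def[symmetric] e using elim by simp
  qed
  from Lim_transform_eventually[OF lim[unfolded limit] this] show ?thesis .
qed

theorem corollary4:
  fixes f :: "real \<times> real \<Rightarrow> real" and L P \<sigma> \<gamma> :: real
    and xs ys :: "real \<Rightarrow> real"
    and \<pi> :: "real \<Rightarrow> real \<Rightarrow> real measure"
  assumes "0 < P" and "0 < \<sigma>" and "0 < \<gamma>"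
    and optimal: "\<And>Q. 0 \<le> Q \<Longrightarrow> optimal_reserves f L Q (xs Q, ys Q)"
    and smooth: "C2_on {0<..} (pool_value f L)"
    and invariant: "\<And>rate \<delta>. 0 < rate \<Longrightarrow> 0 < \<delta> \<Longrightarrow>
          invariant_distribution TYPE('w) \<sigma> rate \<gamma> \<delta> (\<pi> rate \<delta>)"
  shows "\<exists>G :: real \<Rightarrow> real.
    (\<forall>\<delta>>0. ((\<lambda>rate. gas_rate xs ys P rate \<gamma> \<delta> (\<pi> rate \<delta>)) \<longlongrightarrow> G \<delta>) at_top) \<and>
    (\<lambda>\<delta>. G \<delta> - \<sigma>\<^sup>2 * P / 2
              * ((deriv ys (P * exp (- \<gamma>)) + exp \<gamma> * deriv ys (P * exp \<gamma>)) / 2)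
              * (\<delta> / (2 * \<gamma>)))
      \<in> o[at_right 0](\<lambda>\<delta>. \<delta>)"
proof (intro exI conjI allI impI)
  \<comment> \<open>Both exits have the same probability, so it factors out, and its product with
    \<open>rate\<close> has the limit supplied by \<open>fast_block_exit_rate\<close>.\<close>
  define G where "G \<delta> = (gas_plus xs ys P \<gamma> \<delta> + gas_minus xs ys P \<gamma> \<delta>)
    * (\<sigma>\<^sup>2 / (2 * ((\<gamma> + \<delta>)\<^sup>2 - \<gamma>\<^sup>2)))" for \<delta>
  show "((\<lambda>rate. gas_rate xs ys P rate \<gamma> \<delta> (\<pi> rate \<delta>)) \<longlongrightarrow> G \<delta>) at_top" if \<delta>: "0 < \<delta>" for \<delta>
  proof -
    define p where "p rate = 1 / (2 + 2 * (sqrt (2 * rate) * (\<gamma> + \<delta>) / \<sigma>)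
      + (sqrt (2 * rate) * (\<gamma> + \<delta>) / \<sigma>)\<^sup>2 * (1 - (\<gamma> / (\<gamma> + \<delta>))\<^sup>2))" for rate
    have "((\<lambda>rate. (gas_plus xs ys P \<gamma> \<delta> + gas_minus xs ys P \<gamma> \<delta>) * (rate * p rate)) \<longlongrightarrow> G \<delta>) at_top"
      unfolding G_def p_def using assms(2,3) \<delta>
      by (intro tendsto_mult tendsto_const fast_block_exit_rate) auto
    moreover have "eventually (\<lambda>rate. (gas_plus xs ys P \<gamma> \<delta> + gas_minus xs ys P \<gamma> \<delta>) * (rate * p rate)
        = gas_rate xs ys P rate \<gamma> \<delta> (\<pi> rate \<delta>)) at_top"
      using eventually_gt_at_top[of 0]
    proof eventually_elim
      case (elim rate)
      \<comment> \<open>The realization may change with \<open>rate\<close> and \<delta>; only the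
        exit probabilities, which do not depend on it, are carried out of this block.\<close>
      obtain M :: "'w measure" and B N z where "mispricing_process M B N rate \<sigma> \<gamma> \<delta> z"
        and stat: "\<And>t. 0 \<le> t \<Longrightarrow> distr M borel (z t) = \<pi> rate \<delta>"
        using invariant[OF elim \<delta>] unfolding invariant_distribution_def by blast
      then interpret mispricing_process M B N rate \<sigma> \<gamma> \<delta> z by blast
      have "measure (\<pi> rate \<delta>) {\<gamma> + \<delta><..} = p rate" "measure (\<pi> rate \<delta>) {..<- (\<gamma> + \<delta>)} = p rate"
        unfolding p_def by (rule stationary_exit_probabilities[OF assms(2,3) \<delta> stat]; assumption)+
      then show ?case by (simp add: gas_rate_def algebra_simps)
    qed
    ultimately show ?thesis by (rule Lim_transform_eventually)
  qed
  obtain V' V'' where V: "\<And>Q. 0 < Q \<Longrightarrow> (pool_value f L has_real_derivative V' Q) (at Q)"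
    and V': "\<And>Q. 0 < Q \<Longrightarrow> (V' has_real_derivative V'' Q) (at Q)"
    using smooth unfolding C2_on_def by auto
  note loss = rebalancing_loss_second_order[OF optimal V V']
  have plus: "((\<lambda>\<delta>. gas_plus xs ys P \<gamma> \<delta> / \<delta>\<^sup>2) \<longlongrightarrow> P * deriv ys (P * exp (- \<gamma>)) / 2) (at_right 0)"
  proof -
    \<comment> \<open>With \<open>P = exp \<gamma> * Q\<close> the cost is
      \<open>exp \<gamma>\<close> times the loss of moving down from the base price
      \<open>Q\<close>, the case \<open>s = - 1\<close>.\<close>
    define Q where "Q = P * exp (- \<gamma>)"
    have Q: "0 < Q" "P = exp \<gamma> * Q" using assms(1) by (auto simp: Q_def exp_minus)
    have eq: "P * exp (- \<gamma> - \<delta>) = Q * exp (- 1 * \<delta>)" for \<delta>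
      by (simp add: Q_def exp_diff exp_minus field_simps)
    have "P * u + exp \<gamma> * v = exp \<gamma> * (Q * u + v)" for u v
      by (simp add: Q(2) distrib_left)
    then have expand: "gas_plus xs ys P \<gamma> \<delta> / \<delta>\<^sup>2
        = exp \<gamma> * ((Q * (xs (Q * exp (- 1 * \<delta>)) - xs Q) + (ys (Q * exp (- 1 * \<delta>)) - ys Q)) / \<delta>\<^sup>2)" for \<delta>
      unfolding gas_plus_def eq Q_def[symmetric] by simp
    have lim: "((\<lambda>\<delta>. exp \<gamma> * ((Q * (xs (Q * exp (- 1 * \<delta>)) - xs Q) + (ys (Q * exp (- 1 * \<delta>)) - ys Q)) / \<delta>\<^sup>2))
        \<longlongrightarrow> exp \<gamma> * (Q * deriv ys Q / 2)) (at_right 0)"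
      by (intro tendsto_mult tendsto_const loss Q) auto
    have "exp \<gamma> * (Q * deriv ys Q / 2) = P * deriv ys Q / 2" by (simp add: Q(2))
    from lim[unfolded this] show ?thesis unfolding expand Q_def[symmetric] .
  qed
  have minus: "((\<lambda>\<delta>. gas_minus xs ys P \<gamma> \<delta> / \<delta>\<^sup>2) \<longlongrightarrow> P * exp \<gamma> * deriv ys (P * exp \<gamma>) / 2) (at_right 0)"
  proof -
    \<comment> \<open>Already a loss at the base price \<open>P * exp \<gamma>\<close>, moving up:
      the case \<open>s = 1\<close>.\<close>
    have "gas_minus xs ys P \<gamma> \<delta> = P * exp \<gamma> * (xs (P * exp \<gamma> * exp (1 * \<delta>)) - xs (P * exp \<gamma>))
        + (ys (P * exp \<gamma> * exp (1 * \<delta>)) - ys (P * exp \<gamma>))" for \<delta>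
      by (simp add: gas_minus_def exp_add mult.assoc mult.left_commute)
    then show ?thesis using loss[of "P * exp \<gamma>" 1] assms(1) by simp
  qed
  \<comment> \<open>The coefficient of \<delta> in the asserted expansion.\<close>
  define C where "C = \<sigma>\<^sup>2 * P / 2 * ((deriv ys (P * exp (- \<gamma>)) + exp \<gamma> * deriv ys (P * exp \<gamma>)) / 2) / (2 * \<gamma>)"
  have prefactor: "((\<lambda>\<delta>. \<sigma>\<^sup>2 / (2 * (2 * \<gamma> + \<delta>))) \<longlongrightarrow> \<sigma>\<^sup>2 / (2 * (2 * \<gamma> + 0))) (at_right 0)"
    using assms(3) by (intro tendsto_intros) auto
  then have "((\<lambda>\<delta>. (gas_plus xs ys P \<gamma> \<delta> / \<delta>\<^sup>2 + gas_minus xs ys P \<gamma> \<delta> / \<delta>\<^sup>2) * (\<sigma>\<^sup>2 / (2 * (2 * \<gamma> + \<delta>))) - C)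
    \<longlongrightarrow> (P * deriv ys (P * exp (- \<gamma>)) / 2 + P * exp \<gamma> * deriv ys (P * exp \<gamma>) / 2)
        * (\<sigma>\<^sup>2 / (2 * (2 * \<gamma> + 0))) - C) (at_right 0)"
    by (intro tendsto_diff tendsto_mult tendsto_add tendsto_const plus minus)
  also have "(P * deriv ys (P * exp (- \<gamma>)) / 2 + P * exp \<gamma> * deriv ys (P * exp \<gamma>) / 2)
        * (\<sigma>\<^sup>2 / (2 * (2 * \<gamma> + 0))) - C = 0"
    using assms(3) by (simp add: C_def field_simps)
  finally have lim: "((\<lambda>\<delta>. (gas_plus xs ys P \<gamma> \<delta> / \<delta>\<^sup>2 + gas_minus xs ys P \<gamma> \<delta> / \<delta>\<^sup>2)
      * (\<sigma>\<^sup>2 / (2 * (2 * \<gamma> + \<delta>))) - C) \<longlongrightarrow> 0) (at_right 0)" .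
  have "eventually (\<lambda>\<delta>. (gas_plus xs ys P \<gamma> \<delta> / \<delta>\<^sup>2 + gas_minus xs ys P \<gamma> \<delta> / \<delta>\<^sup>2)
      * (\<sigma>\<^sup>2 / (2 * (2 * \<gamma> + \<delta>))) - C = (G \<delta> - C * \<delta>) / \<delta>) (at_right 0)"
    using eventually_at_right_less[of 0]
  proof eventually_elim
    case (elim \<delta>)
    define g where "g = gas_plus xs ys P \<gamma> \<delta> + gas_minus xs ys P \<gamma> \<delta>"
    \<comment> \<open>One factor \<delta> of the denominator of \<open>G\<close> cancels against the
      losses of order \<open>\<delta>\<^sup>2\<close>, and \<open>2 * \<gamma> + \<delta>\<close>
      tends to \<open>2 * \<gamma>\<close>.\<close>
    have "(\<gamma> + \<delta>)\<^sup>2 - \<gamma>\<^sup>2 = \<delta> * (2 * \<gamma> + \<delta>)" by (simp add: power2_eq_square algebra_simps)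
    then show ?case
      using elim assms(3) unfolding G_def add_divide_distrib[symmetric] g_def[symmetric]
      by (simp add: diff_divide_distrib power2_eq_square)
  qed
  with lim have "((\<lambda>\<delta>. (G \<delta> - C * \<delta>) / \<delta>) \<longlongrightarrow> 0) (at_right 0)" by (rule Lim_transform_eventually)
  moreover have "eventually (\<lambda>\<delta>::real. \<delta> \<noteq> 0) (at_right 0)" by (simp add: eventually_at_filter)
  ultimately have "(\<lambda>\<delta>. G \<delta> - C * \<delta>) \<in> o[at_right 0](\<lambda>\<delta>. \<delta>)" by (rule smalloI_tendsto)
  then show "(\<lambda>\<delta>. G \<delta> - \<sigma>\<^sup>2 * P / 2
              * ((deriv ys (P * exp (- \<gamma>)) + exp \<gamma> * deriv ys (P * exp \<gamma>)) / 2)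
              * (\<delta> / (2 * \<gamma>))) \<in> o[at_right 0](\<lambda>\<delta>. \<delta>)"
    by (simp add: C_def)
qed

end
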